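(* Let $G$ be a finite group. Let $F_u=\ast_{g\in G}\langle f_g\rangle$ be the free product of cyclic groups $\langle f_g\rangle\simeq\mathbb Z_{o(g)}$, one for each $g\in G$, let $R_u$ be the kernel of the homomorphism $F_u\to G$, $f_g\mapsto g$, and let $E_u=F_u/[R_u,F_u]$. Let $\Gamma_{\mathrm u}G$ be the unitary cover of $G$. Then $\Gamma_{\mathrm u}G$ and $E_u$ are naturally isomorphic, via an isomorphism pairing the generators $(g,1_u)\in\Gamma_{\mathrm u}G$ and $[R_u,F_u]f_g\in E_u$ for all $g\in G$.
   Context: $Z^2G=Z^2(G,\mathbb C^\times)$ is the group of functions $\alpha:G\times G\to\mathbb C^\times$ with $\alpha(x,y)\alpha(xy,z)=\alpha(x,yz)\alpha(y,z)$ under pointwise multiplication. For a finite subgroup $S\le Z^2G$ put $\check S=\mathrm{Hom}(S,\mathbb C^\times)$; the Schur construction $\check S\propto G$ is the group with underlying set $G\times\check S$ and product $(g,\vartheta)(h,\psi)=(gh,\omega(g,h)\vartheta\psi)$, where $\omega(g,h)\in\check S$ is $\alpha\mapsto\alpha(g,h)$. The group $Z_{\mathrm u}G$ of unitary cocycles is the (finite) subgroup of all $\alpha\in Z^2G$ with $\prod_{j=0}^{o(g)-1}\alpha(g,g^j)=1$ for all $g\in G$. The unitary cover is $\Gamma_{\mathrm u}G=(Z_{\mathrm u}G)\check{\ }\propto G$, and $1_u$ denotes the trivial character of $Z_{\mathrm u}G$. $o(g)$ is the order of $g$. *)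

theory Defs
  imports "HOL-Algebra.Algebra" Complex_Main
begin

definition complex_units :: "complex monoid" where
  "complex_units = \<lparr>carrier = - {0}, monoid.mult = (*), one = 1\<rparr>"

text \<open>
  Functions with a restricted domain (cocycles on \<open>G \<times> G\<close>, characters of a subgroup) are
  represented extensionally: they are \<^const>\<open>undefined\<close> off their domain, so that HOL equality is
  equality on the domain.
\<close>

definition cocycle_group :: "('a, 'b) monoid_scheme \<Rightarrow> ('a \<times> 'a \<Rightarrow> complex) monoid" where
  "cocycle_group G =
    \<lparr>carrier = {\<alpha> \<in> carrier G \<times> carrier G \<rightarrow>\<^sub>E carrier complex_units.
        \<forall>x\<in>carrier G. \<forall>y\<in>carrier G. \<forall>z\<in>carrier G.
          \<alpha> (x, y) * \<alpha> (x \<otimes>\<^bsub>G\<^esub> y, z) = \<alpha> (x, y \<otimes>\<^bsub>G\<^esub> z) * \<alpha> (y, z)},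
     monoid.mult = (\<lambda>\<alpha> \<beta>. \<lambda>p\<in>carrier G \<times> carrier G. \<alpha> p * \<beta> p),
     one = (\<lambda>p\<in>carrier G \<times> carrier G. 1)\<rparr>"

definition unitary_cocycles :: "('a, 'b) monoid_scheme \<Rightarrow> ('a \<times> 'a \<Rightarrow> complex) set" where
  "unitary_cocycles G =
    {\<alpha> \<in> carrier (cocycle_group G).
       \<forall>g\<in>carrier G. (\<Prod>j<group.ord G g. \<alpha> (g, g [^]\<^bsub>G\<^esub> j)) = 1}"

definition character_group :: "('a, 'b) monoid_scheme \<Rightarrow> ('a \<Rightarrow> complex) monoid" where
  "character_group A =
    \<lparr>carrier = hom A complex_units \<inter> extensional (carrier A),
     monoid.mult = (\<lambda>\<theta> \<psi>. \<lambda>a\<in>carrier A. \<theta> a * \<psi> a),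
     one = (\<lambda>a\<in>carrier A. 1)\<rparr>"

text \<open>The group dual to a set \<open>S\<close> of cocycles that is a subgroup of \<open>cocycle_group G\<close>.\<close>

abbreviation cocycle_dual ::
  "('a, 'b) monoid_scheme \<Rightarrow> ('a \<times> 'a \<Rightarrow> complex) set \<Rightarrow> (('a \<times> 'a \<Rightarrow> complex) \<Rightarrow> complex) monoid"
  where "cocycle_dual G S \<equiv> character_group ((cocycle_group G)\<lparr>carrier := S\<rparr>)"

definition cocycle_eval ::
  "('a \<times> 'a \<Rightarrow> complex) set \<Rightarrow> 'a \<Rightarrow> 'a \<Rightarrow> ('a \<times> 'a \<Rightarrow> complex) \<Rightarrow> complex" where
  "cocycle_eval S g h = (\<lambda>\<alpha>\<in>S. \<alpha> (g, h))"

text \<open>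
  Cocycles need not be normalized, so the neutral element of the Schur construction is
  \<open>(1, \<omega>(1,1)\<^sup>-\<^sup>1)\<close>; the product forces this choice. For the unitary cocycles it is the pair
  \<open>(1, 1)\<close>, since the unitarity condition at \<open>g = 1\<close> reads \<open>\<alpha>(1,1) = 1\<close>.
\<close>

definition schur_construction ::
  "('a, 'b) monoid_scheme \<Rightarrow> ('a \<times> 'a \<Rightarrow> complex) set
     \<Rightarrow> ('a \<times> (('a \<times> 'a \<Rightarrow> complex) \<Rightarrow> complex)) monoid" where
  "schur_construction G S =
    \<lparr>carrier = carrier G \<times> carrier (cocycle_dual G S),
     monoid.mult = (\<lambda>(g, \<theta>) (h, \<psi>).
       (g \<otimes>\<^bsub>G\<^esub> h,
        cocycle_eval S g h \<otimes>\<^bsub>cocycle_dual G S\<^esub> \<theta> \<otimes>\<^bsub>cocycle_dual G S\<^esub> \<psi>)),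
     one = (\<one>\<^bsub>G\<^esub>, inv\<^bsub>cocycle_dual G S\<^esub> cocycle_eval S \<one>\<^bsub>G\<^esub> \<one>\<^bsub>G\<^esub>)\<rparr>"

definition unitary_cover ::
  "('a, 'b) monoid_scheme \<Rightarrow> ('a \<times> (('a \<times> 'a \<Rightarrow> complex) \<Rightarrow> complex)) monoid" where
  "unitary_cover G = schur_construction G (unitary_cocycles G)"

definition unitary_cover_gen ::
  "('a, 'b) monoid_scheme \<Rightarrow> 'a \<Rightarrow> 'a \<times> (('a \<times> 'a \<Rightarrow> complex) \<Rightarrow> complex)" where
  "unitary_cover_gen G g = (g, \<one>\<^bsub>cocycle_dual G (unitary_cocycles G)\<^esub>)"

text \<open>
  The free product of a family \<open>K i\<close> (\<open>i \<in> I\<close>) is the set of words in the disjoint union of the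
  \<open>K i\<close> modulo the congruence generated by multiplying two adjacent letters of the same factor and
  deleting neutral letters; the product is induced by concatenation.
\<close>

definition free_product_words :: "'i set \<Rightarrow> ('i \<Rightarrow> ('x, 'c) monoid_scheme) \<Rightarrow> ('i \<times> 'x) list set" where
  "free_product_words I K = lists (SIGMA i:I. carrier (K i))"

inductive_set free_product_rel ::
  "'i set \<Rightarrow> ('i \<Rightarrow> ('x, 'c) monoid_scheme) \<Rightarrow> (('i \<times> 'x) list \<times> ('i \<times> 'x) list) set"
  for I :: "'i set" and K :: "'i \<Rightarrow> ('x, 'c) monoid_scheme"
  where
    refl: "u \<in> free_product_words I K \<Longrightarrow> (u, u) \<in> free_product_rel I K"
  | sym: "(u, v) \<in> free_product_rel I K \<Longrightarrow> (v, u) \<in> free_product_rel I K"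
  | trans: "(u, v) \<in> free_product_rel I K \<Longrightarrow> (v, w) \<in> free_product_rel I K
      \<Longrightarrow> (u, w) \<in> free_product_rel I K"
  | mult: "u \<in> free_product_words I K \<Longrightarrow> v \<in> free_product_words I K \<Longrightarrow> i \<in> I
      \<Longrightarrow> x \<in> carrier (K i) \<Longrightarrow> y \<in> carrier (K i)
      \<Longrightarrow> (u @ [(i, x), (i, y)] @ v, u @ [(i, x \<otimes>\<^bsub>K i\<^esub> y)] @ v) \<in> free_product_rel I K"
  | one: "u \<in> free_product_words I K \<Longrightarrow> v \<in> free_product_words I K \<Longrightarrow> i \<in> I
      \<Longrightarrow> (u @ [(i, \<one>\<^bsub>K i\<^esub>)] @ v, u @ v) \<in> free_product_rel I K"

definition free_product ::
  "'i set \<Rightarrow> ('i \<Rightarrow> ('x, 'c) monoid_scheme) \<Rightarrow> ('i \<times> 'x) list set monoid" where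
  "free_product I K =
    \<lparr>carrier = free_product_words I K // free_product_rel I K,
     monoid.mult = (\<lambda>A B. \<Union>u\<in>A. \<Union>v\<in>B. free_product_rel I K `` {u @ v}),
     one = free_product_rel I K `` {[]}\<rparr>"

definition free_product_incl ::
  "'i set \<Rightarrow> ('i \<Rightarrow> ('x, 'c) monoid_scheme) \<Rightarrow> 'i \<Rightarrow> 'x \<Rightarrow> ('i \<times> 'x) list set" where
  "free_product_incl I K i x = free_product_rel I K `` {[(i, x)]}"

text \<open>
  The map \<open>free_product I K \<rightarrow> H\<close> induced by homomorphisms \<open>\<phi> i : K i \<rightarrow> H\<close>. The value at a class is
  the common value of the evaluations of the words in it.
\<close>

definition free_product_lift ::
  "('h, 'd) monoid_scheme \<Rightarrow> ('i \<Rightarrow> 'x \<Rightarrow> 'h) \<Rightarrow> ('i \<times> 'x) list set \<Rightarrow> 'h" where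
  "free_product_lift H \<phi> A =
    the_elem ((\<lambda>w. foldr (\<lambda>(i, x) a. \<phi> i x \<otimes>\<^bsub>H\<^esub> a) w \<one>\<^bsub>H\<^esub>) ` A)"

definition commutator_subgroup :: "('a, 'b) monoid_scheme \<Rightarrow> 'a set \<Rightarrow> 'a set \<Rightarrow> 'a set" where
  "commutator_subgroup G H K =
    generate G {h \<otimes>\<^bsub>G\<^esub> k \<otimes>\<^bsub>G\<^esub> inv\<^bsub>G\<^esub> h \<otimes>\<^bsub>G\<^esub> inv\<^bsub>G\<^esub> k | h k. h \<in> H \<and> k \<in> K}"

definition cyclic_free_product :: "('a, 'b) monoid_scheme \<Rightarrow> ('a \<times> int) list set monoid" where
  "cyclic_free_product G = free_product (carrier G) (\<lambda>g. integer_mod_group (group.ord G g))"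

text \<open>
  The generator of \<open>integer_mod_group n\<close> is \<open>1 mod n\<close>: for \<open>n = 1\<close> the carrier is \<open>{0}\<close>.
\<close>

definition cyclic_gen :: "('a, 'b) monoid_scheme \<Rightarrow> 'a \<Rightarrow> ('a \<times> int) list set" where
  "cyclic_gen G g =
    free_product_incl (carrier G) (\<lambda>g. integer_mod_group (group.ord G g)) g
      (1 mod int (group.ord G g))"

text \<open>The homomorphism \<open>f\<^sub>g \<mapsto> g\<close>, given on the factor of index \<open>g\<close> by \<open>k \<mapsto> g\<^sup>k\<close>.\<close>

definition cyclic_free_product_proj :: "('a, 'b) monoid_scheme \<Rightarrow> ('a \<times> int) list set \<Rightarrow> 'a" where
  "cyclic_free_product_proj G = free_product_lift G (\<lambda>g k. g [^]\<^bsub>G\<^esub> k)"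

definition relation_subgroup :: "('a, 'b) monoid_scheme \<Rightarrow> ('a \<times> int) list set set" where
  "relation_subgroup G = kernel (cyclic_free_product G) G (cyclic_free_product_proj G)"

definition relation_commutator :: "('a, 'b) monoid_scheme \<Rightarrow> ('a \<times> int) list set set" where
  "relation_commutator G =
    commutator_subgroup (cyclic_free_product G) (relation_subgroup G) (carrier (cyclic_free_product G))"

definition unitary_extension :: "('a, 'b) monoid_scheme \<Rightarrow> ('a \<times> int) list set set monoid" where
  "unitary_extension G = cyclic_free_product G Mod relation_commutator G"

definition unitary_extension_gen :: "('a, 'b) monoid_scheme \<Rightarrow> 'a \<Rightarrow> ('a \<times> int) list set set" where
  "unitary_extension_gen G g = relation_commutator G #>\<^bsub>cyclic_free_product G\<^esub> cyclic_gen G g"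

end

(* The elements (g, 1) of the unitary cover satisfy (g, 1)^o(g) = (1, 1), which is exactly the
   unitarity condition, so f_g \<mapsto> (g, 1) defines a homomorphism q from E_u = F_u / [R_u, F_u] to the
   cover. It is onto: (g, 1)(h, 1)(gh, 1)^-1 = (1, omega(g, h)), and the omega(g, h) generate the dual
   of Z_u, because every character of Z_u extends to the functions with values in roots of unity.
   It is injective: the central kernel A of E_u \<rightarrow> G is generated by the finitely many
   c(g, h) = f_g f_h f_gh^-1, so an element a \<noteq> 1 of A is detected by a character \<chi> of A; the
   function \<chi> \<circ> c is a unitary cocycle, and the second component of q a takes the value \<chi> a at it. *)

theory Submission
  imports Defs
begin

section \<open>Free products\<close>

text \<open>Of the kernel \<open>A\<close> only finite generation is established, and
  \<open>Z_u\<close> sits in a large group of functions, so characters are extended by adjoining one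
  element at a time; this works because nonzero complex numbers have roots of every order. Values in
  roots of unity matter because a homomorphism on a finite cyclic group of such values is a power
  map, so an extended character becomes a monomial in the coordinates, that is, a product of
  evaluations \<open>\<omega> g h\<close>; on all nonzero complex numbers this fails. That unitary
  cocycles have such values is the effect of unitarity: the power of exponent |G| of such a cocycle
  is the coboundary of a function which unitarity confines to roots of unity of order dividing |G|,
  whence the constant |G|^2.\<close>

context
  fixes I :: "'i set" and K :: "'i \<Rightarrow> ('x, 'c) monoid_scheme"
  assumes group_K: "\<And>i. i \<in> I \<Longrightarrow> group (K i)"
begin

lemma free_product_words_simps [simp]:
  "[] \<in> free_product_words I K"
  "p # w \<in> free_product_words I K
     \<longleftrightarrow> fst p \<in> I \<and> snd p \<in> carrier (K (fst p)) \<and> w \<in> free_product_words I K"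
  "u @ v \<in> free_product_words I K \<longleftrightarrow> u \<in> free_product_words I K \<and> v \<in> free_product_words I K"
  by (cases p; auto simp: free_product_words_def)+

lemma free_product_rel_words:
  assumes "(u, v) \<in> free_product_rel I K"
  shows "u \<in> free_product_words I K \<and> v \<in> free_product_words I K"
  using assms
proof induction
  case (mult u v i x y)
  then show ?case
    by (simp add: group.is_monoid[OF group_K] monoid.m_closed)
next
  case (one u v i)
  then show ?case
    by (simp add: group.is_monoid[OF group_K])
qed auto

lemma equiv_free_product_rel: "equiv (free_product_words I K) (free_product_rel I K)"
proof (rule equivI)
  show "free_product_rel I K \<subseteq> free_product_words I K \<times> free_product_words I K"
    using free_product_rel_words by auto
  show "refl_on (free_product_words I K) (free_product_rel I K)"
    by (auto intro!: refl_onI free_product_rel.refl)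
qed (auto intro!: symI transI intro: free_product_rel.sym free_product_rel.trans)

text \<open>The rules \<open>mult\<close> and \<open>one\<close> already carry a context, which
  \<open>a\<close> and \<open>b\<close> merely enlarge. This makes the relation a congruence, so
  that concatenation descends to classes.\<close>

lemma free_product_rel_append:
  assumes "(u, u') \<in> free_product_rel I K" and "a \<in> free_product_words I K"
    and "b \<in> free_product_words I K"
  shows "(a @ u @ b, a @ u' @ b) \<in> free_product_rel I K"
  using assms
proof induction
  case (refl u)
  then show ?case by (auto intro: free_product_rel.refl)
next
  case (mult u v i x y)
  then show ?case
    using free_product_rel.mult[of "a @ u" I K "v @ b" i x y] by simp
next
  case (one u v i)
  then show ?case
    using free_product_rel.one[of "a @ u" I K "v @ b" i] by simp
qed (blast intro: free_product_rel.sym free_product_rel.trans)+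

lemma free_product_rel_append2:
  assumes "(u, u') \<in> free_product_rel I K" and "(v, v') \<in> free_product_rel I K"
  shows "(u @ v, u' @ v') \<in> free_product_rel I K"
  using free_product_rel_append[OF assms(1), of "[]" v]
    free_product_rel_append[OF assms(2), of u' "[]"] assms[THEN free_product_rel_words]
  by (auto intro: free_product_rel.trans)

abbreviation (input) word_class :: "('i \<times> 'x) list \<Rightarrow> ('i \<times> 'x) list set" where
  "word_class u \<equiv> free_product_rel I K `` {u}"

lemma free_product_carrierE:
  assumes "A \<in> carrier (free_product I K)"
  obtains u where "u \<in> free_product_words I K" and "A = word_class u"
  using assms unfolding free_product_def by (auto elim: quotientE)

lemma word_class_closed:
  "u \<in> free_product_words I K \<Longrightarrow> word_class u \<in> carrier (free_product I K)"
  by (simp add: free_product_def quotientI)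

lemma free_product_mult:
  assumes "u \<in> free_product_words I K" and "v \<in> free_product_words I K"
  shows "word_class u \<otimes>\<^bsub>free_product I K\<^esub> word_class v = word_class (u @ v)"
proof -
  have "word_class (u' @ v') = word_class (u @ v)" if "u' \<in> word_class u" "v' \<in> word_class v" for u' v'
  proof (rule equiv_class_eq[OF equiv_free_product_rel])
    show "(u' @ v', u @ v) \<in> free_product_rel I K"
      using that free_product_rel_append2[of u u' v v'] by (blast intro: free_product_rel.sym)
  qed
  moreover have "u \<in> word_class u" "v \<in> word_class v"
    using assms by (auto intro: free_product_rel.refl)
  ultimately have "(\<Union>u'\<in>word_class u. \<Union>v'\<in>word_class v. word_class (u' @ v')) = word_class (u @ v)"
    by blast
  then show ?thesis
    by (simp add: free_product_def)
qed

lemma free_product_one: "\<one>\<^bsub>free_product I K\<^esub> = word_class []"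
  by (simp add: free_product_def)

lemma free_product_left_inverse:
  assumes "u \<in> free_product_words I K"
  shows "\<exists>v\<in>free_product_words I K. (v @ u, []) \<in> free_product_rel I K"
  using assms
proof (induction u)
  case Nil
  then show ?case
    by (auto intro!: bexI[of _ "[]"] free_product_rel.refl)
next
  case (Cons p u)
  obtain i x where p: "p = (i, x)" by force
  then have i: "i \<in> I" "x \<in> carrier (K i)" and u: "u \<in> free_product_words I K"
    using Cons.prems by auto
  interpret Ki: group "K i" by (rule group_K[OF i(1)])
  obtain v where v: "v \<in> free_product_words I K" "(v @ u, []) \<in> free_product_rel I K"
    using Cons.IH[OF u] by blast
  \<comment> \<open>The inverse letter goes to the end of \<open>v\<close>, where it meets the first
    letter of \<open>p # u\<close>; the two merge to a neutral letter, and \<open>v @ u\<close>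
    remains.\<close>
  let ?w = "v @ [(i, inv\<^bsub>K i\<^esub> x)]"
  have "(?w @ p # u, v @ [(i, \<one>\<^bsub>K i\<^esub>)] @ u) \<in> free_product_rel I K"
    using free_product_rel.mult[OF v(1) u i(1), of "inv\<^bsub>K i\<^esub> x" x] i by (simp add: p)
  then have "(?w @ p # u, []) \<in> free_product_rel I K"
    using free_product_rel.one[OF v(1) u i(1)] v(2) by (blast intro: free_product_rel.trans)
  moreover have "?w \<in> free_product_words I K"
    using v i by simp
  ultimately show ?case by blast
qed

lemma group_free_product: "group (free_product I K)"
proof (rule groupI)
  show "\<one>\<^bsub>free_product I K\<^esub> \<in> carrier (free_product I K)"
    by (simp add: free_product_one word_class_closed)
next
  fix A B assume "A \<in> carrier (free_product I K)" "B \<in> carrier (free_product I K)"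
  then show "A \<otimes>\<^bsub>free_product I K\<^esub> B \<in> carrier (free_product I K)"
    by (elim free_product_carrierE) (simp add: free_product_mult word_class_closed)
next
  fix A B C assume "A \<in> carrier (free_product I K)" "B \<in> carrier (free_product I K)"
    "C \<in> carrier (free_product I K)"
  then show "A \<otimes>\<^bsub>free_product I K\<^esub> B \<otimes>\<^bsub>free_product I K\<^esub> C
      = A \<otimes>\<^bsub>free_product I K\<^esub> (B \<otimes>\<^bsub>free_product I K\<^esub> C)"
    by (elim free_product_carrierE) (simp add: free_product_mult)
next
  fix A assume "A \<in> carrier (free_product I K)"
  then show "\<one>\<^bsub>free_product I K\<^esub> \<otimes>\<^bsub>free_product I K\<^esub> A = A"
    by (elim free_product_carrierE) (simp add: free_product_mult free_product_one)
next
  fix A assume "A \<in> carrier (free_product I K)"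
  then obtain u where u: "u \<in> free_product_words I K" "A = word_class u"
    by (rule free_product_carrierE)
  then obtain v where v: "v \<in> free_product_words I K" "(v @ u, []) \<in> free_product_rel I K"
    using free_product_left_inverse by blast
  then have "word_class v \<otimes>\<^bsub>free_product I K\<^esub> A = \<one>\<^bsub>free_product I K\<^esub>"
    using u by (simp add: free_product_mult free_product_one
        equiv_class_eq[OF equiv_free_product_rel])
  then show "\<exists>B\<in>carrier (free_product I K). B \<otimes>\<^bsub>free_product I K\<^esub> A = \<one>\<^bsub>free_product I K\<^esub>"
    using word_class_closed[OF v(1)] by blast
qed

lemma free_product_incl_hom:
  assumes "i \<in> I"
  shows "free_product_incl I K i \<in> hom (K i) (free_product I K)"
proof (rule homI)
  fix x assume "x \<in> carrier (K i)"
  then show "free_product_incl I K i x \<in> carrier (free_product I K)"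
    using assms by (simp add: free_product_incl_def word_class_closed)
next
  fix x y assume xy: "x \<in> carrier (K i)" "y \<in> carrier (K i)"
  then have "([(i, x), (i, y)], [(i, x \<otimes>\<^bsub>K i\<^esub> y)]) \<in> free_product_rel I K"
    using assms free_product_rel.mult[of "[]" I K "[]" i x y] by simp
  then show "free_product_incl I K i (x \<otimes>\<^bsub>K i\<^esub> y)
      = free_product_incl I K i x \<otimes>\<^bsub>free_product I K\<^esub> free_product_incl I K i y"
    using xy assms
    by (simp add: free_product_incl_def free_product_mult equiv_class_eq[OF equiv_free_product_rel])
qed

lemma free_product_generate:
  "generate (free_product I K) (\<Union>i\<in>I. free_product_incl I K i ` carrier (K i))
     = carrier (free_product I K)" (is "generate ?F ?S = _")
proof
  interpret F: group ?F by (rule group_free_product)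
  show "generate ?F ?S \<subseteq> carrier ?F"
    using free_product_incl_hom by (intro F.generate_incl) (auto simp: hom_def)
  have "word_class u \<in> generate ?F ?S" if "u \<in> free_product_words I K" for u
    using that
  proof (induction u)
    case Nil
    then show ?case
      using generate.one[of ?F ?S] by (simp add: free_product_one)
  next
    case (Cons p u)
    then have "word_class (p # u) = free_product_incl I K (fst p) (snd p) \<otimes>\<^bsub>?F\<^esub> word_class u"
      using free_product_mult[of "[p]" u] by (simp add: free_product_incl_def)
    moreover have "free_product_incl I K (fst p) (snd p) \<in> generate ?F ?S"
      using Cons.prems by (intro generate.incl) auto
    ultimately show ?case
      using Cons by (auto intro: generate.eng)
  qed
  then show "carrier ?F \<subseteq> generate ?F ?S"
    by (auto elim: free_product_carrierE)
qed

section \<open>Universal property of the free product\<close>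

context
  fixes H :: "('h, 'd) monoid_scheme" and \<phi> :: "'i \<Rightarrow> 'x \<Rightarrow> 'h"
  assumes group_H: "group H" and hom_\<phi>: "\<And>i. i \<in> I \<Longrightarrow> \<phi> i \<in> hom (K i) H"
begin

interpretation H: group H by (rule group_H)

abbreviation (input) word_eval :: "('i \<times> 'x) list \<Rightarrow> 'h" where
  "word_eval w \<equiv> foldr (\<lambda>(i, x) a. \<phi> i x \<otimes>\<^bsub>H\<^esub> a) w \<one>\<^bsub>H\<^esub>"

lemma word_eval_closed: "w \<in> free_product_words I K \<Longrightarrow> word_eval w \<in> carrier H"
proof (induction w)
  case (Cons p w)
  obtain i x where p: "p = (i, x)" by force
  then have "\<phi> i x \<in> carrier H"
    using Cons hom_in_carrier[OF hom_\<phi>] by simp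
  then show ?case
    using Cons by (simp add: p)
qed simp

lemma word_eval_append:
  assumes "u \<in> free_product_words I K" "v \<in> free_product_words I K"
  shows "word_eval (u @ v) = word_eval u \<otimes>\<^bsub>H\<^esub> word_eval v"
  using assms
proof (induction u)
  case Nil
  then show ?case using word_eval_closed[of v] by simp
next
  case (Cons p u)
  obtain i x where p: "p = (i, x)" by force
  then have "\<phi> i x \<in> carrier H"
    using Cons hom_in_carrier[OF hom_\<phi>] by simp
  then show ?case
    using Cons word_eval_closed[of u] word_eval_closed[of v]
    by (simp add: H.m_assoc p)
qed

text \<open>Constancy on classes is what makes the image in \<open>free_product_lift\<close> a
  singleton, so that \<open>the_elem\<close> is meaningful.\<close>

lemma word_eval_cong:
  assumes "(u, v) \<in> free_product_rel I K"
  shows "word_eval u = word_eval v"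
  using assms
proof induction
  case (mult u v i x y)
  interpret Ki: group "K i" by (rule group_K[OF mult(3)])
  have "\<phi> i x \<in> carrier H" "\<phi> i y \<in> carrier H" "\<phi> i (x \<otimes>\<^bsub>K i\<^esub> y) = \<phi> i x \<otimes>\<^bsub>H\<^esub> \<phi> i y"
    using mult hom_\<phi>[of i] by (auto simp: hom_def)
  then have "word_eval ([(i, x), (i, y)] @ v) = word_eval ([(i, x \<otimes>\<^bsub>K i\<^esub> y)] @ v)"
    using word_eval_closed[OF mult(2)] by (simp add: H.m_assoc)
  then show ?case
    \<comment> \<open>The fold over the prefix \<open>u\<close> depends only on the value of the
      rest, so equality of the evaluated suffixes is enough.\<close>
    unfolding foldr_append[of _ u] by simp
next
  case (one u v i)
  interpret Ki: group "K i" by (rule group_K[OF one(3)])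
  have "\<phi> i \<one>\<^bsub>K i\<^esub> = \<one>\<^bsub>H\<^esub>"
    using one hom_one[OF hom_\<phi>[of i]] by (simp add: group_H)
  then have "word_eval ([(i, \<one>\<^bsub>K i\<^esub>)] @ v) = word_eval v"
    using word_eval_closed[OF one(2)] by simp
  then show ?case
    unfolding foldr_append[of _ u] by simp
next
  case (trans u v w)
  show ?case by (rule HOL.trans[OF trans(3,4)])
next
  case (sym u v)
  show ?case by (rule HOL.sym[OF sym(2)])
next
  case (refl u)
  show ?case by (rule HOL.refl)
qed

lemma free_product_lift_class:
  assumes "u \<in> free_product_words I K"
  shows "free_product_lift H \<phi> (word_class u) = word_eval u"
proof -
  have "word_eval ` word_class u = {word_eval u}"
  proof
    show "word_eval ` word_class u \<subseteq> {word_eval u}"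
      using word_eval_cong[of u] by (simp add: image_subset_iff)
    show "{word_eval u} \<subseteq> word_eval ` word_class u"
      using free_product_rel.refl[OF assms] by blast
  qed
  then show ?thesis
    by (simp add: free_product_lift_def)
qed

lemma free_product_lift_hom: "free_product_lift H \<phi> \<in> hom (free_product I K) H"
proof (rule homI)
  fix A assume "A \<in> carrier (free_product I K)"
  then show "free_product_lift H \<phi> A \<in> carrier H"
    by (elim free_product_carrierE) (simp add: free_product_lift_class word_eval_closed)
next
  fix A B assume "A \<in> carrier (free_product I K)" "B \<in> carrier (free_product I K)"
  then show "free_product_lift H \<phi> (A \<otimes>\<^bsub>free_product I K\<^esub> B)
      = free_product_lift H \<phi> A \<otimes>\<^bsub>H\<^esub> free_product_lift H \<phi> B"
    by (elim free_product_carrierE)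
      (simp add: free_product_mult free_product_lift_class word_eval_append del: foldr_append)
qed

lemma free_product_lift_incl:
  assumes "i \<in> I" and "x \<in> carrier (K i)"
  shows "free_product_lift H \<phi> (free_product_incl I K i x) = \<phi> i x"
proof -
  have "\<phi> i x \<in> carrier H"
    using assms hom_\<phi> by (auto simp: hom_def)
  then show ?thesis
    using assms by (simp add: free_product_incl_def free_product_lift_class)
qed

end

end

text \<open>Reduction modulo \<open>n\<close> changes an exponent by a multiple of \<open>n\<close>,
  hence of \<open>ord x\<close>.\<close>

lemma (in group) int_pow_hom_integer_mod_group:
  assumes "x \<in> carrier G" and "x [^] (n::nat) = \<one>"
  shows "(\<lambda>k::int. x [^] k) \<in> hom (integer_mod_group n) G"
proof (rule homI)
  fix k l :: int
  have "int (ord x) dvd int n"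
    using assms by (simp add: pow_eq_id)
  moreover have "int n dvd (k + l) - (k + l) mod int n"
    by (simp flip: minus_mod_eq_div_mult)
  ultimately have "x [^] ((k + l) mod int n) = x [^] (k + l)"
    using assms by (metis int_pow_eq dvd_trans)
  then show "x [^] (k \<otimes>\<^bsub>integer_mod_group n\<^esub> l) = x [^] k \<otimes> x [^] l"
    using assms by (simp add: int_pow_mult)
qed (use assms in auto)

section \<open>Extension of characters\<close>

lemma complex_units_simps [simp]:
  "carrier complex_units = - {0}" "x \<otimes>\<^bsub>complex_units\<^esub> y = x * y" "\<one>\<^bsub>complex_units\<^esub> = 1"
  by (simp_all add: complex_units_def)

lemma comm_group_complex_units: "comm_group complex_units"
  by (rule comm_groupI) (auto intro!: bexI[of _ "inverse _"])

lemma inv_complex_units: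
  assumes "z \<noteq> 0" shows "inv\<^bsub>complex_units\<^esub> z = inverse z"
  using assms by (intro group.inv_equality comm_group.axioms(2)[OF comm_group_complex_units]) auto

lemma nat_pow_complex_units [simp]: "z [^]\<^bsub>complex_units\<^esub> (n::nat) = z ^ n"
  by (induction n) auto

lemma int_pow_complex_units:
  assumes "z \<noteq> 0" shows "z [^]\<^bsub>complex_units\<^esub> (k::int) = z powi k"
  using assms by (auto simp: int_pow_def2 power_int_def inv_complex_units power_inverse)

context comm_group
begin

abbreviation (input) characters_on :: "'a set \<Rightarrow> ('a \<Rightarrow> complex) set" where
  "characters_on H \<equiv> hom (G\<lparr>carrier := H\<rparr>) complex_units"

lemma group_hom_character:
  assumes "subgroup H G" and "\<chi> \<in> characters_on H"
  shows "group_hom (G\<lparr>carrier := H\<rparr>) complex_units \<chi>"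
  using assms by (intro group_hom.intro group_hom_axioms.intro subgroup_imp_group
      comm_group_complex_units[THEN comm_group.axioms(2)])

lemma character_nonzero: "\<chi> \<in> characters_on H \<Longrightarrow> h \<in> H \<Longrightarrow> \<chi> h \<noteq> 0"
  by (auto simp: hom_def)

lemma character_mult:
  "\<chi> \<in> characters_on H \<Longrightarrow> g \<in> H \<Longrightarrow> h \<in> H \<Longrightarrow> \<chi> (g \<otimes> h) = \<chi> g * \<chi> h"
  by (auto simp: hom_def)

lemma character_int_pow:
  assumes "subgroup H G" and "\<chi> \<in> characters_on H" and "h \<in> H"
  shows "\<chi> (h [^] (k::int)) = \<chi> h powi k"
  using group_hom.hom_int_pow[OF group_hom_character[OF assms(1,2)], of h k] assms
  by (simp add: int_pow_complex_units character_nonzero flip: int_pow_consistent)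

lemma character_one:
  assumes "subgroup H G" and "\<chi> \<in> characters_on H" shows "\<chi> \<one> = 1"
  using group_hom.hom_one[OF group_hom_character[OF assms]] by simp

text \<open>The hypothesis on \<open>w\<close> says that \<open>\<chi>\<close> and the map sending
  the k-th power of \<open>a\<close> to \<open>w powi k\<close> agree where \<open>H\<close> meets
  the cyclic group of \<open>a\<close>; this is exactly what makes the combined map well
  defined.\<close>

lemma character_extend_insert:
  assumes H: "subgroup H G" and \<chi>: "\<chi> \<in> characters_on H" and a: "a \<in> carrier G" and "w \<noteq> 0"
    and w: "\<And>k::int. a [^] k \<in> H \<Longrightarrow> \<chi> (a [^] k) = w powi k"
  obtains \<chi>' where "\<chi>' \<in> characters_on (generate G (insert a H))" and "\<chi>' a = w"
    and "\<And>h. h \<in> H \<Longrightarrow> \<chi>' h = \<chi> h"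
proof -
  interpret H: subgroup H G by (rule H)
  define E where "E = {h \<otimes> a [^] k | h k. h \<in> H \<and> (k::int) \<in> UNIV}"
  \<comment> \<open>The value is read off from any factorization of \<open>x\<close>;
    \<open>\<chi>'_eq\<close> shows that the choice does not matter. The map is controlled on
    \<open>E\<close>, the product of \<open>H\<close> and the cyclic group of \<open>a\<close>,
    which contains the generated subgroup.\<close>
  define \<chi>' where "\<chi>' x = (SOME z. \<exists>h\<in>H. \<exists>k::int. x = h \<otimes> a [^] k \<and> z = \<chi> h * w powi k)" for x
  have \<chi>'_eq: "\<chi>' (h \<otimes> a [^] k) = \<chi> h * w powi k" if h: "h \<in> H" for h and k :: int
    unfolding \<chi>'_def
  proof (rule some_equality)
    fix z assume "\<exists>h'\<in>H. \<exists>l::int. h \<otimes> a [^] k = h' \<otimes> a [^] l \<and> z = \<chi> h' * w powi l"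
    then obtain h' and l :: int where h': "h' \<in> H" "h \<otimes> a [^] k = h' \<otimes> a [^] l" "z = \<chi> h' * w powi l"
      by blast
    \<comment> \<open>Two factorizations differ by an element of \<open>H\<close> that is a power of
      \<open>a\<close>, where the hypothesis on \<open>w\<close> applies.\<close>
    have "a [^] (k - l) = h' \<otimes> inv h"
    proof -
      have "h' = h \<otimes> a [^] k \<otimes> inv (a [^] l)"
        using h h' a by (simp add: inv_solve_right)
      then have "h' = a [^] (k - l) \<otimes> h"
        using h a by (simp add: int_pow_diff m_ac)
      then show ?thesis
        using h h' a by (simp add: inv_solve_right)
    qed
    moreover from this have "\<chi> (a [^] (k - l)) = w powi (k - l)"
      using h h' w[of "k - l"] by simp
    moreover have "h' = h' \<otimes> inv h \<otimes> h"
      using h h' by (simp add: m_assoc)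
    then have "\<chi> h' = \<chi> (h' \<otimes> inv h) * \<chi> h"
      using h h' character_mult[OF \<chi>, of "h' \<otimes> inv h" h] by simp
    ultimately show "z = \<chi> h * w powi k"
      using h'(3) \<open>w \<noteq> 0\<close> by (simp add: power_int_diff)
  qed (use h in blast)
  have E_mult: "(h \<otimes> a [^] k) \<otimes> (h' \<otimes> a [^] l) = (h \<otimes> h') \<otimes> a [^] (k + l)"
    if "h \<in> H" "h' \<in> H" for h h' and k l :: int
    using that a by (simp add: int_pow_mult m_ac)
  have "subgroup E G"
  proof
    show "E \<subseteq> carrier G"
      using a by (auto simp: E_def)
    show "\<one> \<in> E"
      unfolding E_def by (rule CollectI, rule exI[of _ \<one>], rule exI[of _ 0]) simp
    show "x \<otimes> y \<in> E" if "x \<in> E" "y \<in> E" for x y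
      using that E_mult unfolding E_def by blast
    show "inv x \<in> E" if "x \<in> E" for x
    proof -
      from that obtain h and k :: int where "h \<in> H" "x = h \<otimes> a [^] k"
        unfolding E_def by blast
      then have "inv x = inv h \<otimes> a [^] (- k)"
        using a by (simp add: inv_mult int_pow_neg)
      then show ?thesis
        unfolding E_def using \<open>h \<in> H\<close> by blast
    qed
  qed
  moreover have "h \<in> E" if "h \<in> H" for h
    unfolding E_def by (rule CollectI, rule exI[of _ h], rule exI[of _ 0]) (simp add: that)
  moreover have "a \<in> E"
    unfolding E_def by (rule CollectI, rule exI[of _ \<one>], rule exI[of _ 1]) (simp add: a)
  ultimately have sub: "generate G (insert a H) \<subseteq> E"
    by (intro generate_subgroup_incl) auto
  show thesis
  proof
    have "\<chi>' x \<noteq> 0" if "x \<in> E" for x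
      using that \<open>w \<noteq> 0\<close> unfolding E_def by (auto simp: \<chi>'_eq character_nonzero[OF \<chi>])
    moreover have "\<chi>' (x \<otimes> y) = \<chi>' x * \<chi>' y" if xy: "x \<in> E" "y \<in> E" for x y
    proof -
      from xy obtain h h' and k l :: int
        where "h \<in> H" "x = h \<otimes> a [^] k" "h' \<in> H" "y = h' \<otimes> a [^] l"
        unfolding E_def by blast
      then show ?thesis
        using \<open>w \<noteq> 0\<close> by (simp add: E_mult \<chi>'_eq character_mult[OF \<chi>] power_int_add)
    qed
    ultimately show "\<chi>' \<in> characters_on (generate G (insert a H))"
      using sub by (intro homI) (simp_all add: subset_iff)
    show "\<chi>' a = w"
      using \<chi>'_eq[of \<one> 1] a by (simp add: character_one[OF H \<chi>])
    show "\<chi>' h = \<chi> h" if "h \<in> H" for h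
      using \<chi>'_eq[of h 0] that by simp
  qed
qed

text \<open>The exponents \<open>k\<close> that bring \<open>a\<close> into \<open>H\<close> form a
  subgroup of the integers. If it is zero, any nonzero value works; if it is generated by
  \<open>n\<close>, any n-th root of \<open>\<chi> (a [^] n)\<close> works.\<close>

lemma character_value_exists:
  assumes H: "subgroup H G" and \<chi>: "\<chi> \<in> characters_on H" and a: "a \<in> carrier G"
  obtains w where "w \<noteq> 0" and "\<And>k::int. a [^] k \<in> H \<Longrightarrow> \<chi> (a [^] k) = w powi k"
proof (cases "\<exists>n::nat. 0 < n \<and> a [^] n \<in> H")
  case False
  have "k = 0" if "a [^] k \<in> H" for k :: int
  proof (cases k rule: int_cases2)
    case (nonneg n)
    then show ?thesis
      using False that by (auto simp: int_pow_int)
  next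
    case (nonpos n)
    then have "a [^] n \<in> H"
      using subgroup.m_inv_closed[OF H that] a by (simp add: int_pow_neg_int)
    then show ?thesis
      using False nonpos by auto
  qed
  then have "\<chi> (a [^] k) = 1 powi k" if "a [^] k \<in> H" for k :: int
    using character_one[OF H \<chi>] that by fastforce
  then show ?thesis
    using that[of 1] by simp
next
  case True
  define n where "n = (LEAST n::nat. 0 < n \<and> a [^] n \<in> H)"
  have n: "0 < n" "a [^] n \<in> H"
    using LeastI_ex[OF True] by (auto simp: n_def)
  \<comment> \<open>A nonzero number has exactly \<open>n\<close> n-th roots; the count is used only
    to obtain one.\<close>
  have "card {z. z ^ n = \<chi> (a [^] n)} \<noteq> 0"
    using n character_nonzero[OF \<chi> n(2)] by (simp add: card_nth_roots)
  then obtain w where w: "w ^ n = \<chi> (a [^] n)"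
    by (metis (mono_tags) Collect_empty_eq card.empty)
  have "\<chi> (a [^] k) = w powi k" if k: "a [^] k \<in> H" for k :: int
  proof -
    \<comment> \<open>Division with remainder: the remainder also brings \<open>a\<close> into
      \<open>H\<close>, so minimality of \<open>n\<close> forces it to be 0.\<close>
    let ?q = "k div int n" and ?r = "nat (k mod int n)"
    have an: "a [^] (int n * q) = (a [^] n) [^] q" for q :: int
      using int_pow_pow[OF a, of "int n" q] by (simp add: int_pow_int)
    have "k = int ?r + int n * ?q"
      using n by simp
    then have "a [^] k = a [^] (int ?r + int n * ?q)"
      by (rule arg_cong)
    then have "a [^] k = a [^] ?r \<otimes> (a [^] n) [^] ?q"
      unfolding int_pow_mult[OF a] an int_pow_int .
    then have "a [^] ?r = a [^] k \<otimes> inv ((a [^] n) [^] ?q)"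
      using a by (simp add: inv_solve_right)
    moreover have "(a [^] n) [^] ?q \<in> H"
      using n H by (simp add: subgroup_int_pow_closed)
    ultimately have "a [^] ?r \<in> H"
      using k H by (simp add: subgroup.m_closed subgroup.m_inv_closed)
    moreover have "?r < n"
      using n by (simp add: nat_less_iff)
    ultimately have "?r = 0"
      using not_less_Least[of ?r "\<lambda>n::nat. 0 < n \<and> a [^] n \<in> H"] unfolding n_def[symmetric] by auto
    then obtain q where q: "k = int n * q"
      using \<open>k = int ?r + int n * ?q\<close> by (metis add_0 of_nat_0)
    then have "\<chi> (a [^] k) = (w ^ n) powi q"
      using an[of q] character_int_pow[OF H \<chi> n(2), of q] w by simp
    then show ?thesis
      by (simp add: q power_int_mult)
  qed
  moreover have "w \<noteq> 0"
    using w n character_nonzero[OF \<chi> n(2)] by (auto simp: zero_power)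
  ultimately show ?thesis
    using that by blast
qed

lemma character_extend_finite:
  assumes "finite S" and "S \<subseteq> carrier G" and H: "subgroup H G" and \<chi>: "\<chi> \<in> characters_on H"
  obtains \<chi>' where "\<chi>' \<in> characters_on (generate G (H \<union> S))" and "\<And>h. h \<in> H \<Longrightarrow> \<chi>' h = \<chi> h"
proof -
  have "\<exists>\<chi>'\<in>characters_on (generate G (H \<union> S)). \<forall>h\<in>H. \<chi>' h = \<chi> h"
    using assms(1,2)
  proof (induction S)
    case empty
    then show ?case
      using \<chi> H generateI[OF H subset_refl] by auto
  next
    case (insert a S)
    let ?K = "generate G (H \<union> S)"
    have sub: "H \<union> S \<subseteq> carrier G" "a \<in> carrier G"
      using insert subgroup.subset[OF H] by auto
    then have K: "subgroup ?K G"
      by (intro generate_is_subgroup)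
    obtain \<chi>1 where \<chi>1: "\<chi>1 \<in> characters_on ?K" "\<forall>h\<in>H. \<chi>1 h = \<chi> h"
      using insert by auto
    obtain w where "w \<noteq> 0" "\<And>k::int. a [^] k \<in> ?K \<Longrightarrow> \<chi>1 (a [^] k) = w powi k"
      using character_value_exists[OF K \<chi>1(1) sub(2)] by blast
    then obtain \<chi>2 where \<chi>2: "\<chi>2 \<in> characters_on (generate G (insert a ?K))"
      "\<And>h. h \<in> ?K \<Longrightarrow> \<chi>2 h = \<chi>1 h"
      using character_extend_insert[OF K \<chi>1(1) sub(2)] by metis
    have "generate G (H \<union> insert a S) \<subseteq> generate G (insert a ?K)"
      by (rule mono_generate) (auto intro: generate.incl)
    then have "\<chi>2 \<in> characters_on (generate G (H \<union> insert a S))"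
      using \<chi>2(1) by (auto simp: hom_def)
    moreover have "\<forall>h\<in>H. \<chi>2 h = \<chi> h"
      using \<chi>2(2) \<chi>1(2) by (simp add: generate.incl)
    ultimately show ?case by blast
  qed
  then show thesis
    using that by blast
qed

text \<open>A character of the cyclic group of \<open>a\<close> that is nontrivial at
  \<open>a\<close> is built first and then extended over the finitely many generators of the whole
  group.\<close>

lemma character_separates:
  assumes S: "finite S" "S \<subseteq> carrier G" "generate G S = carrier G"
    and a: "a \<in> carrier G" "a \<noteq> \<one>"
  obtains \<chi> where "\<chi> \<in> hom G complex_units" and "\<chi> a \<noteq> 1"
proof -
  have "\<exists>w::complex. w \<noteq> 0 \<and> w \<noteq> 1 \<and> (\<forall>k::int. int (ord a) dvd k \<longrightarrow> w powi k = 1)"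
  proof (cases "ord a = 0")
    case True
    \<comment> \<open>\<open>ord a = 0\<close> encodes infinite order. Then 0 is the only multiple
      of the order, and 2 stands for any number other than 0 and 1.\<close>
    then show ?thesis by (intro exI[of _ 2]) auto
  next
    case False
    then have "ord a > 1"
      using a by (metis less_one linorder_neqE_nat ord_eq_1)
    then have "\<not> {z::complex. z ^ ord a = 1} \<subseteq> {1}"
      using card_mono[of "{1}" "{z::complex. z ^ ord a = 1}"] by (auto simp: card_roots_unity_eq)
    then obtain w :: complex where w: "w ^ ord a = 1" "w \<noteq> 1"
      by blast
    have "w powi k = 1" if k: "int (ord a) dvd k" for k
    proof -
      obtain l where "k = int (ord a) * l"
        using k by blast
      then show ?thesis
        using w by (simp add: power_int_mult)
    qed
    moreover have "w \<noteq> 0"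
      using w False by (auto simp: zero_power)
    ultimately show ?thesis
      using w by blast
  qed
  then obtain w :: complex where w: "w \<noteq> 0" "w \<noteq> 1" "\<And>k::int. int (ord a) dvd k \<Longrightarrow> w powi k = 1"
    by blast
  \<comment> \<open>The trivial subgroup is the starting point: adjoining \<open>a\<close> to it
    with value \<open>w\<close> is allowed since \<open>w powi k = 1\<close> for all multiples
    \<open>k\<close> of \<open>ord a\<close>.\<close>
  have triv: "(\<lambda>_. 1) \<in> characters_on {\<one>}"
    by (auto intro!: homI)
  have "1 = w powi k" if "a [^] k \<in> {\<one>}" for k :: int
    using that a w(3) by (simp add: int_pow_eq_id)
  then obtain \<chi>1 where \<chi>1: "\<chi>1 \<in> characters_on (generate G {a, \<one>})" "\<chi>1 a = w"
    using character_extend_insert[OF triv_subgroup triv a(1) w(1)] by metis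
  obtain \<chi> where \<chi>: "\<chi> \<in> characters_on (generate G (generate G {a, \<one>} \<union> S))"
    "\<And>h. h \<in> generate G {a, \<one>} \<Longrightarrow> \<chi> h = \<chi>1 h"
    using character_extend_finite[OF S(1,2) generate_is_subgroup \<chi>1(1)] a by auto
  have "carrier G \<subseteq> generate G (generate G {a, \<one>} \<union> S)"
    unfolding S(3)[symmetric] by (rule mono_generate) auto
  then have "\<chi> \<in> hom G complex_units"
    using \<chi>(1) by (auto simp: hom_def)
  moreover have "\<chi> a \<noteq> 1"
    using \<chi>(2)[of a] \<chi>1(2) w(2) by (simp add: generate.incl)
  ultimately show thesis
    using that by blast
qed

end

section \<open>Unitary cocycles\<close>

text \<open>The ambient group of the cocycles, without the cocycle identity: it has room for the
  functions supported at a single pair, which are in general not cocycles but are needed as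
  coordinates.\<close>

definition function_group :: "'p set \<Rightarrow> ('p \<Rightarrow> complex) monoid" where
  "function_group I = \<lparr>carrier = I \<rightarrow>\<^sub>E (- {0}), monoid.mult = (\<lambda>\<alpha> \<beta>. \<lambda>p\<in>I. \<alpha> p * \<beta> p),
     one = (\<lambda>p\<in>I. 1)\<rparr>"

lemma function_group_simps:
  "carrier (function_group I) = I \<rightarrow>\<^sub>E (- {0})"
  "\<alpha> \<otimes>\<^bsub>function_group I\<^esub> \<beta> = (\<lambda>p\<in>I. \<alpha> p * \<beta> p)"
  "\<one>\<^bsub>function_group I\<^esub> = (\<lambda>p\<in>I. 1)"
  by (simp_all add: function_group_def)

lemma comm_group_function_group: "comm_group (function_group I)"
proof (rule comm_groupI)
  fix \<alpha> assume \<alpha>: "\<alpha> \<in> carrier (function_group I)"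
  then show "\<exists>\<beta>\<in>carrier (function_group I). \<beta> \<otimes>\<^bsub>function_group I\<^esub> \<alpha> = \<one>\<^bsub>function_group I\<^esub>"
    by (intro bexI[of _ "\<lambda>p\<in>I. inverse (\<alpha> p)"])
      (auto simp: function_group_simps PiE_iff fun_eq_iff)
  show "\<one>\<^bsub>function_group I\<^esub> \<otimes>\<^bsub>function_group I\<^esub> \<alpha> = \<alpha>"
    using \<alpha> by (auto simp: function_group_simps PiE_iff extensional_def fun_eq_iff)
qed (auto simp: function_group_simps fun_eq_iff)

lemma inv_function_group:
  assumes "\<alpha> \<in> carrier (function_group I)"
  shows "inv\<^bsub>function_group I\<^esub> \<alpha> = (\<lambda>p\<in>I. inverse (\<alpha> p))"
  using assms by (intro group.inv_equality comm_group.axioms(2)[OF comm_group_function_group])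
    (auto simp: function_group_simps PiE_iff fun_eq_iff)

lemma nat_pow_function_group:
  assumes "\<alpha> \<in> carrier (function_group I)"
  shows "\<alpha> [^]\<^bsub>function_group I\<^esub> (k::nat) = (\<lambda>p\<in>I. \<alpha> p ^ k)"
  by (induction k) (auto simp: function_group_simps nat_pow_def fun_eq_iff)

lemma character_group_simps:
  "carrier (character_group A) = hom A complex_units \<inter> extensional (carrier A)"
  "\<theta> \<otimes>\<^bsub>character_group A\<^esub> \<psi> = (\<lambda>a\<in>carrier A. \<theta> a * \<psi> a)"
  "\<one>\<^bsub>character_group A\<^esub> = (\<lambda>a\<in>carrier A. 1)"
  by (simp_all add: character_group_def)

lemma comm_group_character_group:
  assumes "group A" shows "comm_group (character_group A)"
proof -
  interpret A: group A by (rule assms)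
  show ?thesis
  proof (rule comm_groupI)
    fix \<theta> assume \<theta>: "\<theta> \<in> carrier (character_group A)"
    then show "\<exists>\<psi>\<in>carrier (character_group A). \<psi> \<otimes>\<^bsub>character_group A\<^esub> \<theta> = \<one>\<^bsub>character_group A\<^esub>"
      by (intro bexI[of _ "\<lambda>a\<in>carrier A. inverse (\<theta> a)"])
        (auto simp: character_group_simps hom_def fun_eq_iff Pi_iff)
    show "\<one>\<^bsub>character_group A\<^esub> \<otimes>\<^bsub>character_group A\<^esub> \<theta> = \<theta>"
      using \<theta> by (auto simp: character_group_simps extensional_def fun_eq_iff)
  qed (auto simp: character_group_simps hom_def fun_eq_iff)
qed

locale finite_group = group +
  assumes finite_carrier: "finite (carrier G)"
begin

abbreviation "ZZ \<equiv> unitary_cocycles G"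
abbreviation "GG \<equiv> carrier G \<times> carrier G"
abbreviation "dual \<equiv> cocycle_dual G (unitary_cocycles G)"
abbreviation "\<omega> \<equiv> cocycle_eval (unitary_cocycles G)"

lemma ord_pos: "g \<in> carrier G \<Longrightarrow> 0 < ord g"
  using ord_ge_1[OF finite_carrier] by force

lemma unitary_cocycle_iff:
  "\<alpha> \<in> ZZ \<longleftrightarrow> \<alpha> \<in> carrier (function_group GG)
    \<and> (\<forall>x\<in>carrier G. \<forall>y\<in>carrier G. \<forall>z\<in>carrier G.
          \<alpha> (x, y) * \<alpha> (x \<otimes> y, z) = \<alpha> (x, y \<otimes> z) * \<alpha> (y, z))
    \<and> (\<forall>g\<in>carrier G. (\<Prod>j\<in>{..<ord g}. \<alpha> (g, g [^] j)) = 1)"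
  by (simp add: unitary_cocycles_def cocycle_group_def function_group_simps conj_assoc)

lemma unitary_cocycleD:
  assumes "\<alpha> \<in> ZZ"
  shows "\<alpha> \<in> carrier (function_group GG)"
    and "\<lbrakk>x \<in> carrier G; y \<in> carrier G\<rbrakk> \<Longrightarrow> \<alpha> (x, y) \<noteq> 0"
    and "\<lbrakk>x \<in> carrier G; y \<in> carrier G; z \<in> carrier G\<rbrakk>
      \<Longrightarrow> \<alpha> (x, y) * \<alpha> (x \<otimes> y, z) = \<alpha> (x, y \<otimes> z) * \<alpha> (y, z)"
    and "g \<in> carrier G \<Longrightarrow> (\<Prod>j\<in>{..<ord g}. \<alpha> (g, g [^] j)) = 1"
  using assms by (auto simp: unitary_cocycle_iff function_group_simps)

text \<open>Unitarity at the neutral element, whose order is 1, says that the value at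
  \<open>(\<one>, \<one>)\<close> is 1. The cocycle identity with two neutral arguments spreads this
  to both axes.\<close>

lemma unitary_cocycle_one:
  assumes "\<alpha> \<in> ZZ" and "g \<in> carrier G"
  shows "\<alpha> (\<one>, g) = 1" and "\<alpha> (g, \<one>) = 1"
proof -
  have 1: "\<alpha> (\<one>, \<one>) = 1"
    using unitary_cocycleD(4)[OF assms(1), of \<one>] by (simp add: lessThan_Suc)
  show "\<alpha> (\<one>, g) = 1"
    using unitary_cocycleD(3)[OF assms(1), of \<one> \<one> g] unitary_cocycleD(2)[OF assms(1), of \<one> g]
      assms(2) 1 by simp
  show "\<alpha> (g, \<one>) = 1"
    using unitary_cocycleD(3)[OF assms(1), of g \<one> \<one>] unitary_cocycleD(2)[OF assms(1), of g \<one>]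
      assms(2) 1 by simp
qed

lemma subgroup_unitary_cocycles: "subgroup ZZ (function_group GG)"
proof
  show "ZZ \<subseteq> carrier (function_group GG)"
    using unitary_cocycleD(1) by blast
  show "\<one>\<^bsub>function_group GG\<^esub> \<in> ZZ"
    by (auto simp: unitary_cocycle_iff function_group_simps)
  show "\<alpha> \<otimes>\<^bsub>function_group GG\<^esub> \<beta> \<in> ZZ" if "\<alpha> \<in> ZZ" "\<beta> \<in> ZZ" for \<alpha> \<beta>
  proof -
    have "\<alpha> (x, y) * \<beta> (x, y) * (\<alpha> (x \<otimes> y, z) * \<beta> (x \<otimes> y, z))
        = \<alpha> (x, y \<otimes> z) * \<beta> (x, y \<otimes> z) * (\<alpha> (y, z) * \<beta> (y, z))"
      if "x \<in> carrier G" "y \<in> carrier G" "z \<in> carrier G" for x y z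
      using arg_cong2[OF unitary_cocycleD(3)[OF \<open>\<alpha> \<in> ZZ\<close> that]
          unitary_cocycleD(3)[OF \<open>\<beta> \<in> ZZ\<close> that], of "(*)"]
      by (simp only: mult_ac)
    then show ?thesis
      using that unitary_cocycleD(4)[OF that(1)] unitary_cocycleD(4)[OF that(2)]
      by (auto simp: unitary_cocycle_iff function_group_simps prod.distrib)
  qed
  show "inv\<^bsub>function_group GG\<^esub> \<alpha> \<in> ZZ" if "\<alpha> \<in> ZZ" for \<alpha>
  proof -
    have "inverse (\<alpha> (x, y)) * inverse (\<alpha> (x \<otimes> y, z))
        = inverse (\<alpha> (x, y \<otimes> z)) * inverse (\<alpha> (y, z))"
      if "x \<in> carrier G" "y \<in> carrier G" "z \<in> carrier G" for x y z
      using unitary_cocycleD(3)[OF \<open>\<alpha> \<in> ZZ\<close> that] by (metis inverse_mult_distrib)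
    moreover have "(\<Prod>j\<in>{..<ord g}. inverse (\<alpha> (g, g [^] j))) = 1" if "g \<in> carrier G" for g
      using unitary_cocycleD(4)[OF \<open>\<alpha> \<in> ZZ\<close> that] prod_inversef[of "\<lambda>j. \<alpha> (g, g [^] j)" "{..<ord g}"] by (simp add: o_def)
    ultimately show ?thesis
      using that unitary_cocycleD(2)[OF that]
      by (auto simp: inv_function_group[OF unitary_cocycleD(1)] unitary_cocycle_iff
          function_group_simps)
  qed
qed

text \<open>Bridge between the dual as defined, over the cocycle group, and the extension of
  characters, which takes place in \<open>function_group GG\<close>.\<close>

lemma cocycle_group_restrict: "(cocycle_group G)\<lparr>carrier := ZZ\<rparr> = (function_group GG)\<lparr>carrier := ZZ\<rparr>"
  by (simp add: cocycle_group_def function_group_def)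

text \<open>Multiplying the cocycle identity over the last argument shows that \<open>\<alpha>\<^sup>n\<close> with \<open>n = |G|\<close> is the
  coboundary of \<open>\<mu> x = (\<Prod>z. \<alpha> (x, z))\<close>; unitarity then forces \<open>\<mu> x\<close> to be a root of unity.\<close>

lemma unitary_cocycle_root_of_unity:
  assumes \<alpha>: "\<alpha> \<in> ZZ" and g: "g \<in> carrier G" and h: "h \<in> carrier G"
  shows "\<alpha> (g, h) ^ (order G * order G) = 1"
proof -
  define \<mu> where "\<mu> x = (\<Prod>z\<in>carrier G. \<alpha> (x, z))" for x
  have nz: "\<mu> x \<noteq> 0" if "x \<in> carrier G" for x
    unfolding \<mu>_def using unitary_cocycleD(2)[OF \<alpha> that] finite_carrier by simp
  have cob: "\<alpha> (x, y) ^ order G * \<mu> (x \<otimes> y) = \<mu> x * \<mu> y"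
    if xy: "x \<in> carrier G" "y \<in> carrier G" for x y
  proof -
    have "\<alpha> (x, y) ^ order G * \<mu> (x \<otimes> y) = (\<Prod>z\<in>carrier G. \<alpha> (x, y) * \<alpha> (x \<otimes> y, z))"
      by (simp add: \<mu>_def prod.distrib order_def)
    also have "\<dots> = (\<Prod>z\<in>carrier G. \<alpha> (x, y \<otimes> z)) * \<mu> y"
      unfolding \<mu>_def prod.distrib[symmetric]
      by (rule prod.cong) (use unitary_cocycleD(3)[OF \<alpha>] xy in auto)
    also have "(\<Prod>z\<in>carrier G. \<alpha> (x, y \<otimes> z)) = \<mu> x"
      unfolding \<mu>_def
      by (rule prod.reindex_bij_witness[where i = "\<lambda>z. inv y \<otimes> z" and j = "\<lambda>z. y \<otimes> z"])
        (use xy in \<open>auto simp: m_assoc[symmetric]\<close>)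
    finally show ?thesis .
  qed
  have "\<mu> x ^ order G = 1" if x: "x \<in> carrier G" for x
  proof -
    \<comment> \<open>Shifting the index trades the factor at exponent 0 for the one at exponent
      \<open>k\<close>. For \<open>k = ord x\<close> both are \<open>\<mu> \<one>\<close>, so the
      two products coincide.\<close>
    have tele: "(\<Prod>j<k. \<mu> (x [^] j)) * \<mu> (x [^] k) = (\<Prod>j<k. \<mu> (x [^] Suc j)) * \<mu> \<one>" for k :: nat
      by (induction k) simp_all
    have pow: "x \<otimes> x [^] j = x [^] Suc j" for j :: nat
      using nat_pow_Suc2[OF x] by simp
    \<comment> \<open>The inserted factor is 1 by unitarity. With it \<open>cob\<close> applies to
      each index, and cancelling the shifted product leaves
      \<open>\<mu> x ^ ord x = 1\<close>.\<close>
    have "(\<Prod>j\<in>{..<ord x}. \<mu> (x [^] Suc j)) = (\<Prod>j\<in>{..<ord x}. \<alpha> (x, x [^] j)) ^ order G * (\<Prod>j\<in>{..<ord x}. \<mu> (x [^] Suc j))"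
      using unitary_cocycleD(4)[OF \<alpha> x] by simp
    also have "\<dots> = (\<Prod>j\<in>{..<ord x}. \<alpha> (x, x [^] j) ^ order G * \<mu> (x \<otimes> x [^] j))"
      unfolding pow by (simp only: prod.distrib prod_power_distrib)
    also have "\<dots> = (\<Prod>j\<in>{..<ord x}. \<mu> x * \<mu> (x [^] j))"
      using x by (intro prod.cong refl cob) auto
    also have "\<dots> = \<mu> x ^ ord x * (\<Prod>j\<in>{..<ord x}. \<mu> (x [^] j))"
      by (simp add: prod.distrib)
    also have "(\<Prod>j\<in>{..<ord x}. \<mu> (x [^] j)) = (\<Prod>j\<in>{..<ord x}. \<mu> (x [^] Suc j))"
      using tele[of "ord x"] x nz[of \<one>] by simp
    finally have "\<mu> x ^ ord x = 1"
      using x nz by simp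
    moreover obtain k where "order G = ord x * k"
      using ord_dvd_group_order[OF x] by blast
    ultimately show ?thesis
      by (simp add: power_mult)
  qed
  then have "(\<mu> g * \<mu> h) ^ order G = 1" "\<mu> (g \<otimes> h) ^ order G = 1"
    using g h by (simp_all add: power_mult_distrib)
  then show ?thesis
    using arg_cong[OF cob[OF g h], of "\<lambda>z. z ^ order G"] by (simp add: power_mult power_mult_distrib)
qed

section \<open>The unitary cover\<close>

lemma dual_simps [simp]:
  "\<theta> \<otimes>\<^bsub>dual\<^esub> \<psi> = (\<lambda>\<alpha>\<in>ZZ. \<theta> \<alpha> * \<psi> \<alpha>)" "\<one>\<^bsub>dual\<^esub> = (\<lambda>\<alpha>\<in>ZZ. 1)"
  by (simp_all add: character_group_simps)

lemma carrier_dual: "carrier dual = hom ((function_group GG)\<lparr>carrier := ZZ\<rparr>) complex_units \<inter> extensional ZZ"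
  by (simp add: character_group_simps cocycle_group_restrict)

lemma comm_group_dual: "comm_group dual"
  unfolding cocycle_group_restrict
  using comm_group.axioms(2)[OF comm_group_function_group] subgroup_unitary_cocycles
  by (intro comm_group_character_group group.subgroup_imp_group)

sublocale dual: comm_group dual
  by (rule comm_group_dual)

lemma dual_mult_closed [intro]:
  "\<theta> \<in> carrier dual \<Longrightarrow> \<psi> \<in> carrier dual \<Longrightarrow> (\<lambda>\<alpha>\<in>ZZ. \<theta> \<alpha> * \<psi> \<alpha>) \<in> carrier dual"
  using dual.m_closed by simp

lemma dual_one_closed [simp]: "(\<lambda>\<alpha>\<in>ZZ. 1) \<in> carrier dual"
  using dual.one_closed by simp

lemma cocycle_eval_closed [intro]:
  assumes "g \<in> carrier G" "h \<in> carrier G" shows "\<omega> g h \<in> carrier dual"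
  using assms unitary_cocycleD(2)
  by (auto simp: carrier_dual cocycle_eval_def hom_def function_group_simps
      subgroup.m_closed[OF subgroup_unitary_cocycles, unfolded function_group_simps])

lemma cocycle_eval_one:
  assumes "g \<in> carrier G" shows "\<omega> \<one> g = \<one>\<^bsub>dual\<^esub>" "\<omega> g \<one> = \<one>\<^bsub>dual\<^esub>"
  using unitary_cocycle_one assms by (auto simp: cocycle_eval_def fun_eq_iff)

text \<open>Pointwise form of the product, in which identities in the cover become identities
  between values of each cocycle. The neutral element loses its correction term because unitary
  cocycles are normalized.\<close>

lemma unitary_cover_simps:
  "carrier (unitary_cover G) = carrier G \<times> carrier dual"
  "(g, \<theta>) \<otimes>\<^bsub>unitary_cover G\<^esub> (h, \<psi>) = (g \<otimes> h, \<lambda>\<alpha>\<in>ZZ. \<alpha> (g, h) * \<theta> \<alpha> * \<psi> \<alpha>)"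
  "\<one>\<^bsub>unitary_cover G\<^esub> = (\<one>, \<lambda>\<alpha>\<in>ZZ. 1)"
proof -
  show "\<one>\<^bsub>unitary_cover G\<^esub> = (\<one>, \<lambda>\<alpha>\<in>ZZ. 1)"
    using dual.inv_one by (simp add: unitary_cover_def schur_construction_def cocycle_eval_one)
qed (auto simp: unitary_cover_def schur_construction_def cocycle_eval_def fun_eq_iff)

lemma unitary_cover_mult_closed:
  assumes "g \<in> carrier G" "h \<in> carrier G" "\<theta> \<in> carrier dual" "\<psi> \<in> carrier dual"
  shows "(\<lambda>\<alpha>\<in>ZZ. \<alpha> (g, h) * \<theta> \<alpha> * \<psi> \<alpha>) \<in> carrier dual"
proof -
  have "\<omega> g h \<otimes>\<^bsub>dual\<^esub> \<theta> \<otimes>\<^bsub>dual\<^esub> \<psi> \<in> carrier dual"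
    using assms by (intro dual.m_closed cocycle_eval_closed)
  moreover have "\<omega> g h \<otimes>\<^bsub>dual\<^esub> \<theta> \<otimes>\<^bsub>dual\<^esub> \<psi> = (\<lambda>\<alpha>\<in>ZZ. \<alpha> (g, h) * \<theta> \<alpha> * \<psi> \<alpha>)"
    by (auto simp: cocycle_eval_def fun_eq_iff)
  ultimately show ?thesis by simp
qed

lemma group_unitary_cover: "group (unitary_cover G)"
proof (rule groupI; (elim SigmaE | simp only: unitary_cover_simps(1))?)
  show "\<one>\<^bsub>unitary_cover G\<^esub> \<in> carrier G \<times> carrier dual"
    by (simp add: unitary_cover_simps)
next
  fix x y assume "x \<in> carrier G \<times> carrier dual" "y \<in> carrier G \<times> carrier dual"
  then show "x \<otimes>\<^bsub>unitary_cover G\<^esub> y \<in> carrier G \<times> carrier dual"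
    by (auto simp: unitary_cover_simps unitary_cover_mult_closed)
next
  fix x y z
  assume "x \<in> carrier G \<times> carrier dual" "y \<in> carrier G \<times> carrier dual" "z \<in> carrier G \<times> carrier dual"
  then obtain g h k \<theta> \<psi> \<chi> where [simp]: "x = (g, \<theta>)" "y = (h, \<psi>)" "z = (k, \<chi>)"
    and ghk: "g \<in> carrier G" "h \<in> carrier G" "k \<in> carrier G" by auto
  have "\<alpha> (g \<otimes> h, k) * (\<alpha> (g, h) * \<theta> \<alpha> * \<psi> \<alpha>) * \<chi> \<alpha>
      = \<alpha> (g, h \<otimes> k) * \<theta> \<alpha> * (\<alpha> (h, k) * \<psi> \<alpha> * \<chi> \<alpha>)" if "\<alpha> \<in> ZZ" for \<alpha>
    \<comment> \<open>Associativity is the cocycle identity times the factor contributed by the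
      three characters.\<close>
    using arg_cong[OF unitary_cocycleD(3)[OF that ghk], of "\<lambda>z. z * (\<theta> \<alpha> * \<psi> \<alpha> * \<chi> \<alpha>)"]
    by (simp only: mult_ac)
  then show "x \<otimes>\<^bsub>unitary_cover G\<^esub> y \<otimes>\<^bsub>unitary_cover G\<^esub> z
      = x \<otimes>\<^bsub>unitary_cover G\<^esub> (y \<otimes>\<^bsub>unitary_cover G\<^esub> z)"
    using ghk by (simp add: unitary_cover_simps m_assoc fun_eq_iff)
next
  fix x assume "x \<in> carrier G \<times> carrier dual"
  then obtain g \<theta> where [simp]: "x = (g, \<theta>)" and g: "g \<in> carrier G" and \<theta>: "\<theta> \<in> carrier dual"
    by auto
  show "\<one>\<^bsub>unitary_cover G\<^esub> \<otimes>\<^bsub>unitary_cover G\<^esub> x = x"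
    using g \<theta>
    by (auto simp: unitary_cover_simps unitary_cocycle_one carrier_dual extensional_def fun_eq_iff)
  have "\<omega> (inv g) g \<otimes>\<^bsub>dual\<^esub> \<theta> \<in> carrier dual"
    using g \<theta> by (intro dual.m_closed cocycle_eval_closed) auto
  then obtain \<psi> where \<psi>: "\<psi> \<in> carrier dual" "\<psi> \<otimes>\<^bsub>dual\<^esub> (\<omega> (inv g) g \<otimes>\<^bsub>dual\<^esub> \<theta>) = \<one>\<^bsub>dual\<^esub>"
    using dual.l_inv_ex by blast
  have "\<alpha> (inv g, g) * \<psi> \<alpha> * \<theta> \<alpha> = 1" if "\<alpha> \<in> ZZ" for \<alpha>
    using fun_cong[OF \<psi>(2), of \<alpha>] that by (simp add: cocycle_eval_def mult_ac)
  then have "(inv g, \<psi>) \<otimes>\<^bsub>unitary_cover G\<^esub> x = \<one>\<^bsub>unitary_cover G\<^esub>"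
    using g by (auto simp: unitary_cover_simps fun_eq_iff)
  then show "\<exists>y\<in>carrier G \<times> carrier dual. y \<otimes>\<^bsub>unitary_cover G\<^esub> x = \<one>\<^bsub>unitary_cover G\<^esub>"
    using g \<psi>(1) by (intro bexI[of _ "(inv g, \<psi>)"]) auto
qed

sublocale cover: group "unitary_cover G"
  by (rule group_unitary_cover)

lemma unitary_cover_gen_closed [intro]:
  "g \<in> carrier G \<Longrightarrow> unitary_cover_gen G g \<in> carrier (unitary_cover G)"
  by (simp add: unitary_cover_gen_def unitary_cover_simps)

lemma unitary_cover_gen_pow_ord:
  assumes g: "g \<in> carrier G"
  shows "unitary_cover_gen G g [^]\<^bsub>unitary_cover G\<^esub> ord g = \<one>\<^bsub>unitary_cover G\<^esub>"
proof -
  have "unitary_cover_gen G g [^]\<^bsub>unitary_cover G\<^esub> n = (g [^] n, \<lambda>\<alpha>\<in>ZZ. \<Prod>j<n. \<alpha> (g, g [^] j))" for n :: nat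
  proof (induction n)
    case 0
    then show ?case by (simp add: unitary_cover_simps fun_eq_iff)
  next
    case (Suc n)
    \<comment> \<open>The generator is split off on the left, so that the new factor is
      \<open>\<alpha> (g, g [^] n)\<close>, with the arguments in the order of the unitarity
      condition.\<close>
    have "unitary_cover_gen G g [^]\<^bsub>unitary_cover G\<^esub> Suc n
        = unitary_cover_gen G g \<otimes>\<^bsub>unitary_cover G\<^esub> unitary_cover_gen G g [^]\<^bsub>unitary_cover G\<^esub> n"
      using g by (intro cover.nat_pow_Suc2 unitary_cover_gen_closed)
    also have "\<dots> = (g [^] Suc n, \<lambda>\<alpha>\<in>ZZ. \<Prod>j<Suc n. \<alpha> (g, g [^] j))"
      unfolding Suc.IH nat_pow_Suc2[OF g]
      by (auto simp: unitary_cover_gen_def unitary_cover_simps fun_eq_iff mult.commute)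
    finally show ?case .
  qed
  from this[of "ord g"] show ?thesis
    using g unitary_cocycleD(4) by (auto simp: unitary_cover_simps fun_eq_iff)
qed

end

context finite_group
begin

text \<open>The characters of \<open>Z\<^sub>u\<close> extend to the ambient group of functions with values in the roots of
  unity, and there every character is a monomial in the coordinates.\<close>

lemma dual_character_monomial:
  assumes \<theta>: "\<theta> \<in> carrier dual"
  obtains m where "\<And>\<alpha>. \<alpha> \<in> ZZ \<Longrightarrow> \<theta> \<alpha> = (\<Prod>p\<in>GG. \<alpha> p ^ m p)"
proof -
  let ?F = "function_group GG"
  interpret F: comm_group ?F by (rule comm_group_function_group)
  define n where "n = order G * order G"
  have n: "0 < n"
    using finite_carrier by (simp add: n_def order_gt_0_iff_finite)
  define \<zeta> where "\<zeta> = cis (2 * pi / real n)"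
  have \<zeta>_nz: "\<zeta> \<noteq> 0"
    by (simp add: \<zeta>_def)
  have \<zeta>: "\<exists>k::nat. z = \<zeta> ^ k" if "z ^ n = 1" for z
  proof -
    have "z \<in> (\<lambda>k. cis (2 * pi * real k / real n)) ` {..<n}"
      using bij_betw_roots_unity[OF n] that by (auto simp: bij_betw_def)
    then show ?thesis
      by (auto simp: \<zeta>_def Complex.DeMoivre mult_ac)
  qed
  \<comment> \<open>The coordinate functions: \<open>\<delta> p\<close> takes the primitive n-th
    root \<open>\<zeta>\<close> at \<open>p\<close> and 1 elsewhere. Together with \<open>ZZ\<close>
    they generate the group to which \<open>\<theta>\<close> is extended.\<close>
  define \<delta> where "\<delta> p = (\<lambda>q\<in>GG. if q = p then \<zeta> else 1)" for p
  have \<delta>: "\<delta> p \<in> carrier ?F" for p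
    using \<zeta>_nz by (auto simp: \<delta>_def function_group_simps)
  let ?H = "generate ?F (ZZ \<union> \<delta> ` GG)"
  have sub: "ZZ \<union> \<delta> ` GG \<subseteq> carrier ?F"
    using \<delta> unitary_cocycleD(1) by auto
  then have H: "subgroup ?H ?F"
    by (rule F.generate_is_subgroup)
  have "\<theta> \<in> hom (?F\<lparr>carrier := ZZ\<rparr>) complex_units"
    using \<theta> by (simp add: carrier_dual)
  then obtain \<theta>' where \<theta>': "\<theta>' \<in> hom (?F\<lparr>carrier := ?H\<rparr>) complex_units"
    "\<And>\<alpha>. \<alpha> \<in> ZZ \<Longrightarrow> \<theta>' \<alpha> = \<theta> \<alpha>"
    using F.character_extend_finite[OF _ _ subgroup_unitary_cocycles, of "\<delta> ` GG" \<theta>] \<delta>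
      finite_carrier by blast
  have \<delta>H: "\<delta> p \<in> ?H" if "p \<in> GG" for p
    using that by (blast intro: generate.incl)
  have pow: "\<theta>' (\<alpha> [^]\<^bsub>?F\<^esub> k) = \<theta>' \<alpha> ^ k" if "\<alpha> \<in> ?H" for \<alpha> and k :: nat
    using F.character_int_pow[OF H \<theta>'(1) that, of "int k"] by (simp add: int_pow_int)
  have "\<exists>j::nat. \<theta>' (\<delta> p) = \<zeta> ^ j" if p: "p \<in> GG" for p
  proof (rule \<zeta>)
    have "\<zeta> ^ n = 1"
      using n by (simp add: \<zeta>_def Complex.DeMoivre)
    then have "\<delta> p [^]\<^bsub>?F\<^esub> n = \<one>\<^bsub>?F\<^esub>"
      unfolding nat_pow_function_group[OF \<delta>] by (auto simp: \<delta>_def function_group_simps fun_eq_iff)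
    then show "\<theta>' (\<delta> p) ^ n = 1"
      using pow[OF \<delta>H[OF p], of n] F.character_one[OF H \<theta>'(1)] by simp
  qed
  then obtain m :: "'a \<times> 'a \<Rightarrow> nat" where m: "\<And>p. p \<in> GG \<Longrightarrow> \<theta>' (\<delta> p) = \<zeta> ^ m p"
    by metis
  have "\<theta> \<alpha> = (\<Prod>p\<in>GG. \<alpha> p ^ m p)" if \<alpha>: "\<alpha> \<in> ZZ" for \<alpha>
  proof -
    \<comment> \<open>The function \<open>\<alpha>\<close> cut off to 1 outside \<open>Y\<close>. It
      is a product of powers of the \<open>\<delta> p\<close> with \<open>p\<close> in
      \<open>Y\<close>, so the monomial formula follows by induction on \<open>Y\<close>;
      \<open>Y = GG\<close> gives \<open>\<alpha>\<close> back.\<close>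
    define part where "part Y = (\<lambda>q\<in>GG. if q \<in> Y then \<alpha> q else 1)" for Y
    have "part Y \<in> ?H \<and> \<theta>' (part Y) = (\<Prod>p\<in>Y. \<alpha> p ^ m p)" if "finite Y" "Y \<subseteq> GG" for Y
      using that
    proof (induction Y)
      case empty
      have "part {} = \<one>\<^bsub>?F\<^esub>"
        by (simp add: part_def function_group_simps)
      then show ?case
        using F.character_one[OF H \<theta>'(1)] generate.one[of ?F] by simp
    next
      case (insert p Y)
      then have p: "p \<in> GG" by simp
      have "\<alpha> p ^ n = 1"
        using p unitary_cocycle_root_of_unity[OF \<alpha>] by (auto simp: n_def)
      then obtain k :: nat where k: "\<alpha> p = \<zeta> ^ k"
        using \<zeta> by blast
      have part: "part (insert p Y) = \<delta> p [^]\<^bsub>?F\<^esub> k \<otimes>\<^bsub>?F\<^esub> part Y"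
        unfolding nat_pow_function_group[OF \<delta>] using insert(2) k
        by (auto simp: \<delta>_def part_def function_group_simps fun_eq_iff)
      have "\<delta> p [^]\<^bsub>?F\<^esub> k \<in> ?H"
        using F.subgroup_int_pow_closed[OF H \<delta>H[OF p], of "int k"] by (simp add: int_pow_int)
      \<comment> \<open>The exponents change places: the k-th power of \<open>\<zeta> ^ m p\<close>
        is the power of \<open>\<zeta> ^ k = \<alpha> p\<close> with exponent \<open>m p\<close>,
        which does not depend on \<open>\<alpha>\<close>.\<close>
      moreover have "\<theta>' (\<delta> p [^]\<^bsub>?F\<^esub> k) = \<alpha> p ^ m p"
        by (simp add: pow[OF \<delta>H[OF p]] m[OF p] k mult.commute flip: power_mult)
      ultimately show ?case
        using insert F.character_mult[OF \<theta>'(1)] by (simp add: part generate.eng)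
    qed
    moreover have "part GG = \<alpha>"
      using unitary_cocycleD(1)[OF \<alpha>]
      by (auto simp: part_def function_group_simps PiE_iff extensional_def fun_eq_iff)
    ultimately show ?thesis
      using finite_carrier \<theta>'(2)[OF \<alpha>] by fastforce
  qed
  then show thesis
    using that by blast
qed

lemma unitary_cover_generate:
  "generate (unitary_cover G) (unitary_cover_gen G ` carrier G) = carrier (unitary_cover G)"
    (is "?K = _")
proof
  show "?K \<subseteq> carrier (unitary_cover G)"
    by (rule cover.generate_incl) (auto intro: unitary_cover_gen_closed)
  have K: "subgroup ?K (unitary_cover G)"
    by (rule cover.generate_is_subgroup) (auto intro: unitary_cover_gen_closed)
  \<comment> \<open>The part of \<open>?K\<close> over the neutral element, seen inside the dual. It
    is closed under products and contains all \<open>\<omega> g h\<close>, hence all monomials in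
    them.\<close>
  define T where "T = {\<theta> \<in> carrier dual. (\<one>, \<theta>) \<in> ?K}"
  have T_mult: "(\<lambda>\<alpha>\<in>ZZ. \<theta> \<alpha> * \<psi> \<alpha>) \<in> T" if "\<theta> \<in> T" "\<psi> \<in> T" for \<theta> \<psi>
  proof -
    have "(\<one>, \<lambda>\<alpha>\<in>ZZ. \<theta> \<alpha> * \<psi> \<alpha>) = (\<one>, \<theta>) \<otimes>\<^bsub>unitary_cover G\<^esub> (\<one>, \<psi>)"
      by (auto simp: unitary_cover_simps unitary_cocycle_one fun_eq_iff)
    then show ?thesis
      using that dual_mult_closed by (auto simp: T_def intro: generate.eng)
  qed
  have T_one: "(\<lambda>\<alpha>\<in>ZZ. 1) \<in> T"
    using generate.one[of "unitary_cover G"] by (simp add: T_def unitary_cover_simps)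
  have T_eval: "\<omega> g h \<in> T" if g: "g \<in> carrier G" and h: "h \<in> carrier G" for g h
  proof -
    let ?f = "unitary_cover_gen G"
    have \<omega>: "(\<one>, \<omega> g h) \<in> carrier (unitary_cover G)"
      using g h by (simp add: unitary_cover_simps cocycle_eval_closed)
    have "(\<one>, \<omega> g h) \<otimes>\<^bsub>unitary_cover G\<^esub> ?f (g \<otimes> h) = ?f g \<otimes>\<^bsub>unitary_cover G\<^esub> ?f h"
      using g h by (auto simp: unitary_cover_gen_def unitary_cover_simps unitary_cocycle_one
          cocycle_eval_def fun_eq_iff)
    then have "(\<one>, \<omega> g h) = ?f g \<otimes>\<^bsub>unitary_cover G\<^esub> ?f h \<otimes>\<^bsub>unitary_cover G\<^esub> inv\<^bsub>unitary_cover G\<^esub> ?f (g \<otimes> h)"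
      using g h \<omega> by (simp add: cover.inv_solve_right unitary_cover_gen_closed)
    also have "\<dots> \<in> ?K"
      using g h by (intro generate.eng generate.incl generate.inv) auto
    finally show ?thesis
      using g h by (simp add: T_def cocycle_eval_closed)
  qed
  have T_pow: "(\<lambda>\<alpha>\<in>ZZ. \<theta> \<alpha> ^ k) \<in> T" if "\<theta> \<in> T" for \<theta> and k :: nat
  proof (induction k)
    case (Suc k)
    have "(\<lambda>\<alpha>\<in>ZZ. \<theta> \<alpha> ^ Suc k) = (\<lambda>\<alpha>\<in>ZZ. \<theta> \<alpha> * (\<lambda>\<alpha>\<in>ZZ. \<theta> \<alpha> ^ k) \<alpha>)"
      by auto
    then show ?case
      using T_mult[OF that Suc] by (simp only:)
  next
    case 0
    show ?case
      unfolding power_0 by (rule T_one)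
  qed
  have T: "\<theta> \<in> T" if \<theta>: "\<theta> \<in> carrier dual" for \<theta>
  proof -
    obtain m where m: "\<And>\<alpha>. \<alpha> \<in> ZZ \<Longrightarrow> \<theta> \<alpha> = (\<Prod>p\<in>GG. \<alpha> p ^ m p)"
      using dual_character_monomial[OF \<theta>] by blast
    have "(\<lambda>\<alpha>\<in>ZZ. \<Prod>p\<in>Y. \<alpha> p ^ m p) \<in> T" if "finite Y" "Y \<subseteq> GG" for Y
      using that
    proof (induction Y)
      case empty
      show ?case
        unfolding prod.empty by (rule T_one)
    next
      case (insert p Y)
      have monomial: "(\<lambda>\<alpha>\<in>ZZ. \<omega> (fst p) (snd p) \<alpha> ^ m p) \<in> T"
        using insert.prems by (intro T_pow T_eval) auto
      have IH: "(\<lambda>\<alpha>\<in>ZZ. \<Prod>p\<in>Y. \<alpha> p ^ m p) \<in> T"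
        using insert.prems by (intro insert.IH) simp
      have "(\<lambda>\<alpha>\<in>ZZ. \<Prod>q\<in>insert p Y. \<alpha> q ^ m q)
          = (\<lambda>\<alpha>\<in>ZZ. (\<lambda>\<alpha>\<in>ZZ. \<omega> (fst p) (snd p) \<alpha> ^ m p) \<alpha> * (\<lambda>\<alpha>\<in>ZZ. \<Prod>p\<in>Y. \<alpha> p ^ m p) \<alpha>)"
        using insert.hyps by (auto simp: cocycle_eval_def fun_eq_iff)
      then show ?case
        using T_mult[OF monomial IH] by (simp only:)
    qed
    from this[of GG] have "(\<lambda>\<alpha>\<in>ZZ. \<Prod>p\<in>GG. \<alpha> p ^ m p) \<in> T"
      using finite_carrier by simp
    moreover have "(\<lambda>\<alpha>\<in>ZZ. \<Prod>p\<in>GG. \<alpha> p ^ m p) = \<theta>"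
      using \<theta> m by (auto simp: carrier_dual extensional_def fun_eq_iff)
    ultimately show ?thesis by simp
  qed
  show "carrier (unitary_cover G) \<subseteq> ?K"
  proof
    fix x assume "x \<in> carrier (unitary_cover G)"
    then obtain g \<theta> where x: "x = (g, \<theta>)" "g \<in> carrier G" "\<theta> \<in> carrier dual"
      by (auto simp: unitary_cover_simps)
    then have "x = (\<one>, \<theta>) \<otimes>\<^bsub>unitary_cover G\<^esub> unitary_cover_gen G g"
      by (auto simp: unitary_cover_gen_def unitary_cover_simps unitary_cocycle_one carrier_dual
          extensional_def fun_eq_iff)
    then show "x \<in> ?K"
      using T[OF x(3)] x(2) by (auto simp: T_def intro: generate.eng generate.incl)
  qed
qed

end

text \<open>Inverses of torsion generators are nonnegative powers, so an induction over the
  generated subgroup needs only left multiplication by a generator.\<close>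

lemma (in group) generate_torsion_induct [consumes 2, case_names torsion one mult]:
  assumes S: "S \<subseteq> carrier G" and x: "x \<in> generate G S"
    and torsion: "\<And>s. s \<in> S \<Longrightarrow> \<exists>n::nat. 0 < n \<and> s [^] n = \<one>"
    and one: "P \<one>"
    and mult: "\<And>s y. s \<in> S \<Longrightarrow> y \<in> carrier G \<Longrightarrow> P y \<Longrightarrow> P (s \<otimes> y)"
  shows "P x"
proof -
  \<comment> \<open>The elements whose left multiplication preserves \<open>P\<close>. Unlike
    \<open>P\<close> itself, membership in \<open>T\<close> passes to arbitrary products.\<close>
  define T where "T = {t \<in> carrier G. \<forall>y\<in>carrier G. P y \<longrightarrow> P (t \<otimes> y)}"
  have S_T: "s \<in> T" if "s \<in> S" for s
    using that S mult by (auto simp: T_def)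
  have T_mult: "s \<otimes> t \<in> T" if "s \<in> T" "t \<in> T" for s t
    using that by (auto simp: T_def m_assoc)
  have T_one: "\<one> \<in> T"
    by (simp add: T_def)
  have T_pow: "s [^] n \<in> T" if "s \<in> S" for s and n :: nat
    by (induction n) (use T_one T_mult S_T that in auto)
  have "x \<in> T"
    using x
  proof induction
    case (inv s)
    obtain n :: nat where n: "0 < n" "s [^] n = \<one>"
      using torsion[OF inv] by blast
    have s: "s \<in> carrier G"
      using inv S by blast
    have "s [^] (n - 1) \<otimes> s = \<one>"
      using n by (metis Suc_diff_1 nat_pow_Suc)
    then have "inv s = s [^] (n - 1)"
      using s by (intro inv_equality) auto
    then show ?case
      using T_pow[OF inv] by simp
  qed (use T_one S_T T_mult in auto)
  then show ?thesis
    using one by (auto simp: T_def dest!: bspec[where x = \<one>])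
qed

section \<open>Central extensions generated by a torsion section\<close>

text \<open>All that is used of \<open>E_u\<close>: a central extension of \<open>G\<close> with a
  section \<open>f\<close> whose values generate it and satisfy the relations of the cyclic factors.
  Words and cosets do not enter below.\<close>

locale unitary_section = finite_group +
  fixes E (structure) and p f
  assumes group_E: "group E" and p_hom: "p \<in> hom E G"
    and f_closed: "\<And>g. g \<in> carrier G \<Longrightarrow> f g \<in> carrier E"
    and p_f: "\<And>g. g \<in> carrier G \<Longrightarrow> p (f g) = g"
    and f_pow_ord: "\<And>g. g \<in> carrier G \<Longrightarrow> f g [^]\<^bsub>E\<^esub> ord g = \<one>\<^bsub>E\<^esub>"
    and generate_f: "generate E (f ` carrier G) = carrier E"
    and kernel_central: "\<And>a x. \<lbrakk>a \<in> kernel E G p; x \<in> carrier E\<rbrakk>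
      \<Longrightarrow> a \<otimes>\<^bsub>E\<^esub> x = x \<otimes>\<^bsub>E\<^esub> a"
begin

sublocale E: group E
  by (rule group_E)

sublocale p: group_hom E G p
  by unfold_locales (rule p_hom)

abbreviation "A \<equiv> kernel E G p"

lemma kernel_closed: "a \<in> A \<Longrightarrow> a \<in> carrier E"
  by (simp add: kernel_def)

lemma comm_group_kernel: "comm_group (E\<lparr>carrier := A\<rparr>)"
  using E.subgroup_imp_group[OF p.subgroup_kernel] kernel_central
  by (intro group.group_comm_groupI) (auto simp: kernel_closed)

text \<open>The factor set of the section \<open>f\<close>, with values in the central kernel
  \<open>A\<close>.\<close>

definition c :: "'a \<Rightarrow> 'a \<Rightarrow> 'c" where
  "c g h = f g \<otimes>\<^bsub>E\<^esub> f h \<otimes>\<^bsub>E\<^esub> inv\<^bsub>E\<^esub> f (g \<otimes> h)"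

lemma c_kernel: "g \<in> carrier G \<Longrightarrow> h \<in> carrier G \<Longrightarrow> c g h \<in> A"
  by (simp add: c_def kernel_def f_closed p_f)

lemma c_mult:
  "g \<in> carrier G \<Longrightarrow> h \<in> carrier G \<Longrightarrow> c g h \<otimes>\<^bsub>E\<^esub> f (g \<otimes> h) = f g \<otimes>\<^bsub>E\<^esub> f h"
  by (simp add: c_def f_closed E.m_assoc)

lemma f_one: "f \<one> = \<one>\<^bsub>E\<^esub>"
  using f_pow_ord[of \<one>] f_closed[of \<one>] by simp

text \<open>Centrality moves \<open>b\<close> to the front, and the defect of \<open>f\<close> as a
  homomorphism is absorbed by \<open>c\<close>. This is the single step of the inductions
  below.\<close>

lemma f_mult_kernel:
  assumes "g \<in> carrier G" "h \<in> carrier G" "b \<in> A"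
  shows "f g \<otimes>\<^bsub>E\<^esub> (b \<otimes>\<^bsub>E\<^esub> f h) = (b \<otimes>\<^bsub>E\<^esub> c g h) \<otimes>\<^bsub>E\<^esub> f (g \<otimes> h)"
proof -
  have "f g \<otimes>\<^bsub>E\<^esub> (b \<otimes>\<^bsub>E\<^esub> f h) = b \<otimes>\<^bsub>E\<^esub> (f g \<otimes>\<^bsub>E\<^esub> f h)"
    using assms kernel_central[OF assms(3), of "f g"]
    by (simp add: f_closed kernel_closed E.m_assoc[symmetric])
  then show ?thesis
    using assms by (simp add: c_mult[symmetric] f_closed kernel_closed c_kernel E.m_assoc)
qed

lemma E_induct [consumes 1, case_names one mult]:
  assumes "x \<in> carrier E" and "P \<one>\<^bsub>E\<^esub>"
    and "\<And>g y. g \<in> carrier G \<Longrightarrow> y \<in> carrier E \<Longrightarrow> P y \<Longrightarrow> P (f g \<otimes>\<^bsub>E\<^esub> y)"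
  shows "P x"
proof -
  have "f ` carrier G \<subseteq> carrier E"
    using f_closed by blast
  then show ?thesis
    using assms(1)[folded generate_f]
  proof (induction rule: E.generate_torsion_induct)
    case (torsion s)
    then show ?case
      using f_pow_ord ord_pos by blast
  qed (use assms(2,3) in blast)+
qed

text \<open>Each generator multiplied from the left onto a normal form contributes one further value
  of \<open>c\<close>, by \<open>f_mult_kernel\<close>.\<close>

lemma kernel_decomposition:
  assumes "x \<in> carrier E"
  shows "\<exists>b\<in>generate E ((\<lambda>(g, h). c g h) ` GG). x = b \<otimes>\<^bsub>E\<^esub> f (p x)"
  using assms
proof (induction rule: E_induct)
  case one
  then show ?case
    by (auto simp: f_one intro!: bexI[of _ "\<one>\<^bsub>E\<^esub>"] generate.one)
next
  case (mult g y)
  let ?B = "generate E ((\<lambda>(g, h). c g h) ` GG)"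
  obtain b where b: "b \<in> ?B" "y = b \<otimes>\<^bsub>E\<^esub> f (p y)"
    using mult.IH by blast
  have "?B \<subseteq> A"
    using p.subgroup_kernel by (intro E.generate_subgroup_incl) (auto simp: c_kernel)
  then have "f g \<otimes>\<^bsub>E\<^esub> (b \<otimes>\<^bsub>E\<^esub> f (p y)) = (b \<otimes>\<^bsub>E\<^esub> c g (p y)) \<otimes>\<^bsub>E\<^esub> f (p (f g \<otimes>\<^bsub>E\<^esub> y))"
    using mult b(1) by (subst f_mult_kernel) (auto simp: f_closed p_f)
  moreover have "b \<otimes>\<^bsub>E\<^esub> c g (p y) \<in> ?B"
    using mult by (intro generate.eng[OF b(1)] generate.incl) auto
  ultimately show ?case
    unfolding b(2)[symmetric] by blast
qed

text \<open>On the kernel the factor \<open>f (p a)\<close> of the normal form is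
  \<open>f \<one> = \<one>\<close>. The result provides the finite generation needed to separate
  elements of \<open>A\<close> by characters.\<close>

lemma generate_kernel: "generate E ((\<lambda>(g, h). c g h) ` GG) = A"
proof
  show sub: "generate E ((\<lambda>(g, h). c g h) ` GG) \<subseteq> A"
    using p.subgroup_kernel by (intro E.generate_subgroup_incl) (auto simp: c_kernel)
  show "A \<subseteq> generate E ((\<lambda>(g, h). c g h) ` GG)"
  proof
    fix a assume a: "a \<in> A"
    then obtain b where b: "b \<in> generate E ((\<lambda>(g, h). c g h) ` GG)" "a = b \<otimes>\<^bsub>E\<^esub> f (p a)"
      using kernel_decomposition[OF kernel_closed] by blast
    have "b \<in> carrier E"
      using b(1) sub by (intro kernel_closed) (rule subsetD)
    then have "a = b"
      using a b(2) by (simp add: kernel_def f_one)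
    then show "a \<in> generate E ((\<lambda>(g, h). c g h) ` GG)"
      using b(1) by simp
  qed
qed

definition pullback :: "('c \<Rightarrow> complex) \<Rightarrow> 'a \<times> 'a \<Rightarrow> complex" where
  "pullback \<chi> = (\<lambda>(g, h)\<in>GG. \<chi> (c g h))"

lemma pullback_apply [simp]:
  "g \<in> carrier G \<Longrightarrow> h \<in> carrier G \<Longrightarrow> pullback \<chi> (g, h) = \<chi> (c g h)"
  by (simp add: pullback_def)

context
  fixes \<chi> assumes \<chi>: "\<chi> \<in> hom (E\<lparr>carrier := A\<rparr>) complex_units"
begin

lemma \<chi>_mult: "a \<in> A \<Longrightarrow> b \<in> A \<Longrightarrow> \<chi> (a \<otimes>\<^bsub>E\<^esub> b) = \<chi> a * \<chi> b"
  using \<chi> by (auto simp: hom_def)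

lemma \<chi>_nonzero: "a \<in> A \<Longrightarrow> \<chi> a \<noteq> 0"
  using \<chi> by (auto simp: hom_def)

lemma \<chi>_one: "\<chi> \<one>\<^bsub>E\<^esub> = 1"
proof -
  have "\<one>\<^bsub>E\<^esub> \<in> A"
    by (simp add: kernel_def)
  then show ?thesis
    using \<chi>_mult[of "\<one>\<^bsub>E\<^esub>" "\<one>\<^bsub>E\<^esub>"] \<chi>_nonzero[of "\<one>\<^bsub>E\<^esub>"] by simp
qed

lemma A_mult: "a \<in> A \<Longrightarrow> b \<in> A \<Longrightarrow> a \<otimes>\<^bsub>E\<^esub> b \<in> A"
  using subgroup.m_closed[OF p.subgroup_kernel] .

text \<open>The cocycle identity reflects associativity in \<open>E\<close>, and unitarity reflects
  the relation \<open>f_pow_ord\<close>.\<close>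

lemma pullback_unitary: "pullback \<chi> \<in> ZZ"
  unfolding unitary_cocycle_iff
proof (intro conjI ballI)
  show "pullback \<chi> \<in> carrier (function_group GG)"
    by (auto simp: pullback_def function_group_simps \<chi>_nonzero c_kernel)
  show "pullback \<chi> (x, y) * pullback \<chi> (x \<otimes> y, z) = pullback \<chi> (x, y \<otimes> z) * pullback \<chi> (y, z)"
    if xyz: "x \<in> carrier G" "y \<in> carrier G" "z \<in> carrier G" for x y z
  proof -
    note cl = f_closed kernel_closed c_kernel
    \<comment> \<open>The product of \<open>f x\<close>, \<open>f y\<close> and \<open>f z\<close>
      is brought to normal form from either side; the second way moves the central element
      \<open>c y z\<close> past \<open>f x\<close>.\<close>
    have "c x y \<otimes>\<^bsub>E\<^esub> c (x \<otimes> y) z \<otimes>\<^bsub>E\<^esub> f (x \<otimes> y \<otimes> z) = f x \<otimes>\<^bsub>E\<^esub> (f y \<otimes>\<^bsub>E\<^esub> f z)"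
      using xyz by (simp add: cl E.m_assoc c_mult) (simp add: cl E.m_assoc[symmetric] c_mult)
    also have "\<dots> = c y z \<otimes>\<^bsub>E\<^esub> c x (y \<otimes> z) \<otimes>\<^bsub>E\<^esub> f (x \<otimes> (y \<otimes> z))"
      using xyz f_mult_kernel[of x "y \<otimes> z" "c y z"] by (simp add: cl c_mult)
    finally have "c x y \<otimes>\<^bsub>E\<^esub> c (x \<otimes> y) z = c y z \<otimes>\<^bsub>E\<^esub> c x (y \<otimes> z)"
      using xyz by (simp add: cl m_assoc)
    then have "\<chi> (c x y) * \<chi> (c (x \<otimes> y) z) = \<chi> (c y z) * \<chi> (c x (y \<otimes> z))"
      using xyz by (simp add: c_kernel flip: \<chi>_mult)
    then show ?thesis
      using xyz by simp
  qed
  show "(\<Prod>j\<in>{..<ord g}. pullback \<chi> (g, g [^] j)) = 1" if g: "g \<in> carrier G" for g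
  proof -
    \<comment> \<open>The normal form of the k-th power of \<open>f g\<close>, with
      \<open>\<chi> b\<close> as partial product. At \<open>k = ord g\<close> both the power and
      \<open>f (g [^] k)\<close> are neutral, so \<open>b\<close> is neutral too.\<close>
    have "\<exists>b\<in>A. \<chi> b = (\<Prod>j\<in>{..<k}. pullback \<chi> (g, g [^] j)) \<and> f g [^]\<^bsub>E\<^esub> k = b \<otimes>\<^bsub>E\<^esub> f (g [^] k)" for k :: nat
    proof (induction k)
      case 0
      then show ?case
        by (intro bexI[of _ "\<one>\<^bsub>E\<^esub>"]) (auto simp: \<chi>_one f_one kernel_def)
    next
      case (Suc k)
      then obtain b where b: "b \<in> A" "\<chi> b = (\<Prod>j\<in>{..<k}. pullback \<chi> (g, g [^] j))"
        "f g [^]\<^bsub>E\<^esub> k = b \<otimes>\<^bsub>E\<^esub> f (g [^] k)" by blast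
      have "f g [^]\<^bsub>E\<^esub> Suc k = f g \<otimes>\<^bsub>E\<^esub> (b \<otimes>\<^bsub>E\<^esub> f (g [^] k))"
        using E.nat_pow_Suc2[OF f_closed[OF g], of k] b(3) by simp
      also have "\<dots> = (b \<otimes>\<^bsub>E\<^esub> c g (g [^] k)) \<otimes>\<^bsub>E\<^esub> f (g [^] Suc k)"
        unfolding nat_pow_Suc2[OF g] using g b(1) by (intro f_mult_kernel) auto
      finally show ?case
        using g b(1,2) by (intro bexI[of _ "b \<otimes>\<^bsub>E\<^esub> c g (g [^] k)"])
          (simp_all add: \<chi>_mult c_kernel A_mult)
    qed
    from this[of "ord g"] obtain b where "b \<in> A" "\<chi> b = (\<Prod>j\<in>{..<ord g}. pullback \<chi> (g, g [^] j))"
      "\<one>\<^bsub>E\<^esub> = b \<otimes>\<^bsub>E\<^esub> f \<one>"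
      using f_pow_ord[OF g] g by auto
    then show ?thesis
      using \<chi>_one by (simp add: f_one kernel_closed)
  qed
qed

end

section \<open>Homomorphisms from the extension to the unitary cover\<close>

context
  fixes q
  assumes q_hom: "q \<in> hom E (unitary_cover G)"
    and q_f: "\<And>g. g \<in> carrier G \<Longrightarrow> q (f g) = unitary_cover_gen G g"
begin

interpretation q: group_hom E "unitary_cover G" q
  by unfold_locales (rule q_hom)

lemma fst_q:
  assumes "x \<in> carrier E"
  shows "fst (q x) = p x"
  using assms
proof (induction rule: E_induct)
  case one
  then show ?case by (simp add: unitary_cover_simps)
next
  case (mult g y)
  then show ?case
    by (cases "q y") (simp add: f_closed q_f p_f unitary_cover_gen_def unitary_cover_simps)
qed

text \<open>Multiplying by \<open>f g\<close> multiplies the second component at a cocycle by its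
  value at \<open>(g, p y)\<close>, and at \<open>pullback \<chi>\<close> this value is
  \<open>\<chi> (c g (p y))\<close>, the factor gained by \<open>\<chi> b\<close>.\<close>

lemma snd_q:
  assumes \<chi>: "\<chi> \<in> hom (E\<lparr>carrier := A\<rparr>) complex_units" and "x \<in> carrier E"
  shows "\<exists>b\<in>A. x = b \<otimes>\<^bsub>E\<^esub> f (p x) \<and> snd (q x) (pullback \<chi>) = \<chi> b"
  using assms(2)
proof (induction rule: E_induct)
  case one
  then show ?case
    using pullback_unitary[OF \<chi>]
    by (intro bexI[of _ "\<one>\<^bsub>E\<^esub>"]) (auto simp: unitary_cover_simps f_one \<chi>_one[OF \<chi>] kernel_def)
next
  case (mult g y)
  then obtain b where b: "b \<in> A" "y = b \<otimes>\<^bsub>E\<^esub> f (p y)" "snd (q y) (pullback \<chi>) = \<chi> b"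
    by blast
  let ?b = "b \<otimes>\<^bsub>E\<^esub> c g (p y)"
  have py: "p y \<in> carrier G"
    using mult by simp
  have "p (f g \<otimes>\<^bsub>E\<^esub> y) = g \<otimes> p y"
    using mult by (simp add: f_closed p_f)
  then have "f g \<otimes>\<^bsub>E\<^esub> y = ?b \<otimes>\<^bsub>E\<^esub> f (p (f g \<otimes>\<^bsub>E\<^esub> y))"
    unfolding f_mult_kernel[OF mult(1) py b(1), folded b(2)] by simp
  moreover have "snd (q (f g \<otimes>\<^bsub>E\<^esub> y)) (pullback \<chi>) = \<chi> ?b"
    using fst_q[OF mult(2)] mult(1,2) py b(1,3) pullback_unitary[OF \<chi>]
    by (cases "q y") (simp add: f_closed q_f unitary_cover_gen_def unitary_cover_simps
        \<chi>_mult[OF \<chi>] c_kernel mult.commute)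
  moreover have "?b \<in> A"
    using b(1) mult(1) py by (simp add: A_mult[OF \<chi>] c_kernel)
  ultimately show ?case by blast
qed

lemma unitary_cover_iso: "q \<in> iso E (unitary_cover G)"
  unfolding q.iso_iff
proof (intro conjI ballI impI)
  have "carrier (unitary_cover G) = generate (unitary_cover G) (q ` f ` carrier G)"
    by (simp add: unitary_cover_generate[symmetric] image_image q_f cong: image_cong_simp)
  also have "\<dots> = q ` carrier E"
    using f_closed generate_f by (subst q.generate_img) auto
  finally show "carrier (unitary_cover G) \<subseteq> q ` carrier E" by simp
next
  fix x assume x: "x \<in> carrier E" "q x = \<one>\<^bsub>unitary_cover G\<^esub>"
  show "x = \<one>\<^bsub>E\<^esub>"
  proof (rule ccontr)
    assume "x \<noteq> \<one>\<^bsub>E\<^esub>"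
    have px: "p x = \<one>"
      using fst_q[OF x(1)] x(2) by (simp add: unitary_cover_simps)
    then have xA: "x \<in> A"
      using x(1) by (simp add: kernel_def)
    interpret EA: comm_group "E\<lparr>carrier := A\<rparr>"
      by (rule comm_group_kernel)
    let ?C = "(\<lambda>(g, h). c g h) ` GG"
    have "?C \<subseteq> A"
      by (auto simp: c_kernel)
    then have "generate (E\<lparr>carrier := A\<rparr>) ?C = A"
      using E.generate_consistent[OF _ p.subgroup_kernel] generate_kernel by simp
    then obtain \<chi> where \<chi>: "\<chi> \<in> hom (E\<lparr>carrier := A\<rparr>) complex_units" "\<chi> x \<noteq> 1"
      using EA.character_separates[of ?C x] \<open>?C \<subseteq> A\<close> finite_carrier xA \<open>x \<noteq> \<one>\<^bsub>E\<^esub>\<close> by auto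
    obtain b where b: "b \<in> A" "x = b \<otimes>\<^bsub>E\<^esub> f (p x)" "snd (q x) (pullback \<chi>) = \<chi> b"
      using snd_q[OF \<chi>(1) x(1)] by blast
    \<comment> \<open>Since \<open>p x\<close> is neutral, so is \<open>f (p x)\<close>; the
      evaluation of \<open>snd (q x)\<close> at \<open>pullback \<chi>\<close> is therefore
      \<open>\<chi> x\<close> itself.\<close>
    then have "b = x"
      by (simp add: px f_one kernel_closed)
    then have "\<chi> x = 1"
      using b(3) x(2) pullback_unitary[OF \<chi>(1)] by (simp add: unitary_cover_simps)
    then show False
      using \<chi>(2) by simp
  qed
qed

end

end

section \<open>The extension \<open>F\<^sub>u / [R\<^sub>u, F\<^sub>u]\<close>\<close>

text \<open>Conjugating a commutator conjugates both of its entries, and the normal subgroup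
  \<open>H\<close> keeps the first.\<close>

lemma (in group) commutator_subgroup_normal:
  assumes "H \<lhd> G"
  shows "commutator_subgroup G H (carrier G) \<lhd> G"
  unfolding commutator_subgroup_def
proof (rule normal_generateI)
  interpret H: normal H G by (rule assms)
  show "{h \<otimes> k \<otimes> inv h \<otimes> inv k |h k. h \<in> H \<and> k \<in> carrier G} \<subseteq> carrier G"
    by auto
  fix z x assume "z \<in> {h \<otimes> k \<otimes> inv h \<otimes> inv k |h k. h \<in> H \<and> k \<in> carrier G}" and x: "x \<in> carrier G"
  then obtain h k where z: "z = h \<otimes> k \<otimes> inv h \<otimes> inv k" "h \<in> H" "k \<in> carrier G"
    by blast
  have cancel: "inv x \<otimes> (x \<otimes> y) = y" if "y \<in> carrier G" for y
    using x that by (simp add: m_assoc[symmetric])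
  have "x \<otimes> z \<otimes> inv x = (x \<otimes> h \<otimes> inv x) \<otimes> (x \<otimes> k \<otimes> inv x) \<otimes> inv (x \<otimes> h \<otimes> inv x) \<otimes> inv (x \<otimes> k \<otimes> inv x)"
    using x z by (simp add: m_assoc inv_mult_group cancel)
  moreover have "x \<otimes> h \<otimes> inv x \<in> H"
    using x z(2) by (rule H.inv_op_closed2)
  ultimately show "x \<otimes> z \<otimes> inv x \<in> {h \<otimes> k \<otimes> inv h \<otimes> inv k |h k. h \<in> H \<and> k \<in> carrier G}"
    using x z by blast
qed

lemma (in group) commutator_subgroup_mem:
  "h \<in> H \<Longrightarrow> k \<in> K \<Longrightarrow> h \<otimes> k \<otimes> inv h \<otimes> inv k \<in> commutator_subgroup G H K"
  unfolding commutator_subgroup_def by (rule generate.incl) blast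

text \<open>Serves to pass maps on \<open>F_u\<close> to the quotient: once for the projection to
  \<open>G\<close>, once for the map to the cover.\<close>

lemma (in group_hom) commutator_subgroup_kernel:
  assumes "A \<subseteq> carrier G" "B \<subseteq> carrier G"
    and comm: "\<And>a b. a \<in> A \<Longrightarrow> b \<in> B \<Longrightarrow> h a \<otimes>\<^bsub>H\<^esub> h b = h b \<otimes>\<^bsub>H\<^esub> h a"
  shows "commutator_subgroup G A B \<subseteq> kernel G H h"
  unfolding commutator_subgroup_def
proof (rule G.generate_subgroup_incl[OF _ subgroup_kernel], safe)
  fix a b assume ab: "a \<in> A" "b \<in> B"
  then have "a \<in> carrier G" "b \<in> carrier G"
    using assms by auto
  then show "a \<otimes> b \<otimes> inv a \<otimes> inv b \<in> kernel G H h"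
    using comm[OF ab] by (simp add: kernel_def H.m_assoc H.inv_solve_left')
qed

context finite_group
begin

abbreviation "FF \<equiv> cyclic_free_product G"
abbreviation "RR \<equiv> relation_subgroup G"
abbreviation "NN \<equiv> relation_commutator G"

lemma group_cyclic_free_product: "group FF"
  unfolding cyclic_free_product_def by (rule group_free_product) simp

sublocale F: group FF
  by (rule group_cyclic_free_product)

lemma cyclic_incl_hom:
  assumes "g \<in> carrier G"
  shows "group_hom (integer_mod_group (ord g)) FF
    (free_product_incl (carrier G) (\<lambda>g. integer_mod_group (ord g)) g)"
  unfolding cyclic_free_product_def
  using assms
  by (intro group_hom.intro group_hom_axioms.intro group_free_product free_product_incl_hom) auto

lemma cyclic_gen_exponent: "g \<in> carrier G \<Longrightarrow> 1 mod int (ord g) \<in> carrier (integer_mod_group (ord g))"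
  using ord_pos[of g] by (simp add: carrier_integer_mod_group)

lemma cyclic_gen_closed: "g \<in> carrier G \<Longrightarrow> cyclic_gen G g \<in> carrier FF"
  unfolding cyclic_gen_def
  by (rule group_hom.hom_closed[OF cyclic_incl_hom]) (simp_all add: cyclic_gen_exponent)

lemma cyclic_gen_pow:
  assumes g: "g \<in> carrier G"
  shows "cyclic_gen G g [^]\<^bsub>FF\<^esub> (k::nat) =
    free_product_incl (carrier G) (\<lambda>g. integer_mod_group (ord g)) g (int k mod int (ord g))"
  unfolding cyclic_gen_def
  using group_hom.hom_nat_pow[OF cyclic_incl_hom[OF g] cyclic_gen_exponent[OF g], of k]
  by (simp add: mod_mult_right_eq)

lemma cyclic_gen_pow_ord: "g \<in> carrier G \<Longrightarrow> cyclic_gen G g [^]\<^bsub>FF\<^esub> ord g = \<one>\<^bsub>FF\<^esub>"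
  using group_hom.hom_one[OF cyclic_incl_hom] by (simp add: cyclic_gen_pow)

lemma generate_cyclic_gen: "generate FF (cyclic_gen G ` carrier G) = carrier FF"
proof
  let ?K = "\<lambda>g. integer_mod_group (ord g)" and ?S = "cyclic_gen G ` carrier G"
  have S: "?S \<subseteq> carrier FF"
    using cyclic_gen_closed by blast
  then show "generate FF ?S \<subseteq> carrier FF"
    by (rule F.generate_incl)
  have sub: "subgroup (generate FF ?S) FF"
    using S by (rule F.generate_is_subgroup)
  have "free_product_incl (carrier G) ?K g k \<in> generate FF ?S"
    if g: "g \<in> carrier G" and k: "k \<in> carrier (?K g)" for g k
  proof -
    \<comment> \<open>The representatives in \<open>integer_mod_group (ord g)\<close> are reduced
      and nonnegative, as \<open>ord g\<close> is positive; natural powers of the generator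
      therefore exhaust the factor.\<close>
    have "free_product_incl (carrier G) ?K g k = cyclic_gen G g [^]\<^bsub>FF\<^esub> nat k"
      unfolding cyclic_gen_pow[OF g] using k ord_pos[OF g] by (simp add: carrier_integer_mod_group)
    also have "\<dots> \<in> generate FF ?S"
      using F.subgroup_int_pow_closed[OF sub, of "cyclic_gen G g" "int (nat k)"] g
      by (simp only: int_pow_int) (blast intro: generate.incl)
    finally show ?thesis .
  qed
  then have "generate FF (\<Union>g\<in>carrier G. free_product_incl (carrier G) ?K g ` carrier (?K g))
      \<subseteq> generate FF ?S"
    by (intro F.generate_subgroup_incl[OF _ sub]) blast
  then show "carrier FF \<subseteq> generate FF ?S"
    using free_product_generate[of "carrier G" ?K] by (simp add: cyclic_free_product_def)
qed

lemma cyclic_free_product_lift: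
  assumes "group H" and \<gamma>: "\<And>g. g \<in> carrier G \<Longrightarrow> \<gamma> g \<in> carrier H"
    and ord: "\<And>g. g \<in> carrier G \<Longrightarrow> \<gamma> g [^]\<^bsub>H\<^esub> ord g = \<one>\<^bsub>H\<^esub>"
  defines "l \<equiv> free_product_lift H (\<lambda>g k::int. \<gamma> g [^]\<^bsub>H\<^esub> k)"
  shows "l \<in> hom FF H" and "g \<in> carrier G \<Longrightarrow> l (cyclic_gen G g) = \<gamma> g"
proof -
  interpret H: group H by (rule assms(1))
  have hom: "(\<lambda>k::int. \<gamma> g [^]\<^bsub>H\<^esub> k) \<in> hom (integer_mod_group (ord g)) H" if "g \<in> carrier G" for g
    using that \<gamma> ord by (intro H.int_pow_hom_integer_mod_group)
  then show "l \<in> hom FF H"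
    unfolding l_def cyclic_free_product_def
    by (intro free_product_lift_hom) (simp_all add: assms(1))
  assume g: "g \<in> carrier G"
  have "l (cyclic_gen G g) = \<gamma> g [^]\<^bsub>H\<^esub> (1 mod int (ord g))"
    unfolding l_def cyclic_gen_def using hom g cyclic_gen_exponent
    by (subst free_product_lift_incl) (simp_all add: assms(1))
  also have "\<dots> = \<gamma> g"
  \<comment> \<open>For \<open>ord g = 1\<close> the generator has exponent
    \<open>1 mod 1 = 0\<close>; the value is still correct, because the order hypothesis then makes
    \<open>\<gamma> g\<close> neutral.\<close>
  proof (cases "ord g = 1")
    case True
    then show ?thesis
      using ord[OF g] \<gamma>[OF g] by simp
  next
    case False
    then show ?thesis
      using ord_pos[OF g] \<gamma>[OF g] by simp
  qed
  finally show "l (cyclic_gen G g) = \<gamma> g" .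
qed

abbreviation "pr \<equiv> cyclic_free_product_proj G"

lemma proj_hom: "pr \<in> hom FF G"
  and proj_gen: "g \<in> carrier G \<Longrightarrow> pr (cyclic_gen G g) = g"
  using cyclic_free_product_lift[OF is_group, of "\<lambda>g. g"]
  by (simp_all add: cyclic_free_product_proj_def)

sublocale proj: group_hom FF G pr
  by unfold_locales (rule proj_hom)

lemma relation_subgroup_normal: "RR \<lhd> FF"
  unfolding relation_subgroup_def by (rule proj.normal_kernel)

lemma relation_commutator_normal: "NN \<lhd> FF"
  unfolding relation_commutator_def
  by (rule F.commutator_subgroup_normal[OF relation_subgroup_normal])

lemma group_unitary_extension: "group (unitary_extension G)"
  unfolding unitary_extension_def by (rule normal.factorgroup_is_group[OF relation_commutator_normal])

lemma coset_hom:
  "group_hom FF (unitary_extension G) (\<lambda>w. NN #>\<^bsub>FF\<^esub> w)"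
  using normal.r_coset_hom_Mod[OF relation_commutator_normal] group_unitary_extension
  by (intro group_hom.intro group_hom_axioms.intro group_cyclic_free_product)
    (simp_all add: unitary_extension_def)

lemma unitary_extensionE:
  assumes "x \<in> carrier (unitary_extension G)"
  obtains w where "w \<in> carrier FF" "x = NN #>\<^bsub>FF\<^esub> w"
  using assms by (auto simp: unitary_extension_def FactGroup_def RCOSETS_def)

lemma generate_unitary_extension:
  "generate (unitary_extension G) (unitary_extension_gen G ` carrier G) = carrier (unitary_extension G)"
proof -
  have "(\<lambda>w. NN #>\<^bsub>FF\<^esub> w) ` carrier FF = carrier (unitary_extension G)"
    by (auto simp: unitary_extension_def FactGroup_def RCOSETS_def)
  then show ?thesis
    using group_hom.generate_img[OF coset_hom, of "cyclic_gen G ` carrier G"] cyclic_gen_closed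
    by (simp add: image_image generate_cyclic_gen unitary_extension_gen_def image_subset_iff)
qed

text \<open>The products in the two orders differ by the commutator of \<open>r\<close> and
  \<open>w\<close>, which the quotient kills.\<close>

lemma relation_central:
  assumes r: "r \<in> RR" and w: "w \<in> carrier FF"
  shows "NN #>\<^bsub>FF\<^esub> (r \<otimes>\<^bsub>FF\<^esub> w) = NN #>\<^bsub>FF\<^esub> (w \<otimes>\<^bsub>FF\<^esub> r)"
proof -
  interpret N: normal NN FF by (rule relation_commutator_normal)
  have r': "r \<in> carrier FF"
    using r by (simp add: relation_subgroup_def kernel_def)
  let ?k = "r \<otimes>\<^bsub>FF\<^esub> w \<otimes>\<^bsub>FF\<^esub> inv\<^bsub>FF\<^esub> r \<otimes>\<^bsub>FF\<^esub> inv\<^bsub>FF\<^esub> w"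
  have k: "?k \<in> NN"
    unfolding relation_commutator_def using r w by (rule F.commutator_subgroup_mem)
  have "r \<otimes>\<^bsub>FF\<^esub> w = ?k \<otimes>\<^bsub>FF\<^esub> (w \<otimes>\<^bsub>FF\<^esub> r)"
    using r' w by (simp add: F.m_assoc F.inv_solve_left')
  moreover have "?k \<otimes>\<^bsub>FF\<^esub> (w \<otimes>\<^bsub>FF\<^esub> r) \<in> NN #>\<^bsub>FF\<^esub> (w \<otimes>\<^bsub>FF\<^esub> r)"
    using k r' w N.subset by (intro F.rcosI) auto
  ultimately have "r \<otimes>\<^bsub>FF\<^esub> w \<in> NN #>\<^bsub>FF\<^esub> (w \<otimes>\<^bsub>FF\<^esub> r)"
    by (simp only:)
  then show ?thesis
    using F.repr_independence[OF _ _ N.is_subgroup] r' w by (metis F.m_closed)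
qed

text \<open>Unitary cocycles are 1 as soon as one argument is neutral, and the characters
  commute.\<close>

lemma unitary_cover_kernel_central:
  assumes "(\<one>, \<theta>) \<in> carrier (unitary_cover G)" "x \<in> carrier (unitary_cover G)"
  shows "(\<one>, \<theta>) \<otimes>\<^bsub>unitary_cover G\<^esub> x = x \<otimes>\<^bsub>unitary_cover G\<^esub> (\<one>, \<theta>)"
  using assms by (auto simp: unitary_cover_simps unitary_cocycle_one fun_eq_iff mult.commute)

lemma unitary_extension_iso:
  "\<exists>q\<in>iso (unitary_extension G) (unitary_cover G).
     \<forall>g\<in>carrier G. q (unitary_extension_gen G g) = unitary_cover_gen G g"
proof -
  interpret coset: group_hom FF "unitary_extension G" "\<lambda>w. NN #>\<^bsub>FF\<^esub> w"
    by (rule coset_hom)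
  obtain l where l: "l \<in> hom FF (unitary_cover G)"
    "\<And>g. g \<in> carrier G \<Longrightarrow> l (cyclic_gen G g) = unitary_cover_gen G g"
    using cyclic_free_product_lift[OF group_unitary_cover unitary_cover_gen_closed unitary_cover_gen_pow_ord]
    by blast
  interpret l: group_hom FF "unitary_cover G" l
    by unfold_locales (rule l(1))
  \<comment> \<open>Hence \<open>l\<close> sends \<open>RR\<close> to pairs with neutral first
    component. These are central in the cover, so \<open>l\<close> kills \<open>NN\<close> and
    factors through the quotient.\<close>
  have fst_l: "fst (l w) = pr w" if "w \<in> carrier FF" for w
  proof -
    have S: "cyclic_gen G ` carrier G \<subseteq> carrier FF"
      using cyclic_gen_closed by blast
    show ?thesis
      using S that[folded generate_cyclic_gen]
    proof (induction rule: F.generate_torsion_induct)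
      case (torsion s)
      then show ?case
        using cyclic_gen_pow_ord ord_pos by blast
    next
      case one
      then show ?case by (simp add: unitary_cover_simps)
    next
      case (mult s y)
      then obtain g where g: "g \<in> carrier G" "s = cyclic_gen G g"
        by blast
      then show ?case
        using mult
        by (cases "l y") (simp add: cyclic_gen_closed proj_gen l(2) unitary_cover_gen_def unitary_cover_simps)
    qed
  qed
  have R: "RR \<subseteq> carrier FF"
    by (auto simp: relation_subgroup_def kernel_def)
  have "NN \<subseteq> kernel FF (unitary_cover G) l"
    unfolding relation_commutator_def
  proof (rule l.commutator_subgroup_kernel[OF R order.refl])
    fix r w assume r: "r \<in> RR" and w: "w \<in> carrier FF"
    then have "fst (l r) = \<one>" "l r \<in> carrier (unitary_cover G)"
      using fst_l R by (auto simp: relation_subgroup_def kernel_def)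
    then show "l r \<otimes>\<^bsub>unitary_cover G\<^esub> l w = l w \<otimes>\<^bsub>unitary_cover G\<^esub> l r"
      using unitary_cover_kernel_central[of "snd (l r)" "l w"] w by (metis l.hom_closed prod.collapse)
  qed
  then obtain q where q: "q \<in> hom (unitary_extension G) (unitary_cover G)"
    "\<And>w. w \<in> carrier FF \<Longrightarrow> q (NN #>\<^bsub>FF\<^esub> w) = l w"
    unfolding unitary_extension_def
    using l.FactGroup_universal_kernel[OF relation_commutator_normal] by metis
  have "NN \<subseteq> kernel FF G pr"
    unfolding relation_commutator_def
    by (rule proj.commutator_subgroup_kernel[OF R order.refl])
      (auto simp: relation_subgroup_def kernel_def)
  then obtain p where p: "p \<in> hom (unitary_extension G) G"
    "\<And>w. w \<in> carrier FF \<Longrightarrow> p (NN #>\<^bsub>FF\<^esub> w) = pr w"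
    unfolding unitary_extension_def
    using proj.FactGroup_universal_kernel[OF relation_commutator_normal] by metis
  interpret unitary_section G "unitary_extension G" p "unitary_extension_gen G"
  proof
    fix g assume g: "g \<in> carrier G"
    then show "unitary_extension_gen G g \<in> carrier (unitary_extension G)"
      by (simp add: unitary_extension_gen_def cyclic_gen_closed)
    show "p (unitary_extension_gen G g) = g"
      using g by (simp add: unitary_extension_gen_def cyclic_gen_closed p(2) proj_gen)
    show "unitary_extension_gen G g [^]\<^bsub>unitary_extension G\<^esub> ord g = \<one>\<^bsub>unitary_extension G\<^esub>"
      using g coset.hom_nat_pow[OF cyclic_gen_closed[OF g], of "ord g"]
      by (simp add: unitary_extension_gen_def cyclic_gen_pow_ord)
  next
    fix a x assume a: "a \<in> kernel (unitary_extension G) G p" and x: "x \<in> carrier (unitary_extension G)"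
    then have "a \<in> carrier (unitary_extension G)"
      by (simp add: kernel_def)
    then obtain r where r: "r \<in> carrier FF" "a = NN #>\<^bsub>FF\<^esub> r"
      by (rule unitary_extensionE)
    obtain w where w: "w \<in> carrier FF" "x = NN #>\<^bsub>FF\<^esub> w"
      using x by (rule unitary_extensionE)
    have "r \<in> RR"
      using a r by (simp add: kernel_def relation_subgroup_def p(2))
    then show "a \<otimes>\<^bsub>unitary_extension G\<^esub> x = x \<otimes>\<^bsub>unitary_extension G\<^esub> a"
      using relation_central[of r w] r w by (simp flip: coset.hom_mult)
  qed (use p(1) generate_unitary_extension in auto)
  have "q (unitary_extension_gen G g) = unitary_cover_gen G g" if "g \<in> carrier G" for g
    using that by (simp add: unitary_extension_gen_def q(2) l(2) cyclic_gen_closed)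
  then show ?thesis
    using unitary_cover_iso[OF q(1)] by blast
qed

end

text \<open>The two generation clauses render naturality: a homomorphism is determined by its values
  on generators, so the pairing admits only one isomorphism.\<close>

theorem theorem3p5:
  fixes G :: "('a, 'b) monoid_scheme"
  assumes "group G" and "finite (carrier G)"
  shows "generate (unitary_cover G) (unitary_cover_gen G ` carrier G) = carrier (unitary_cover G)
    \<and> generate (unitary_extension G) (unitary_extension_gen G ` carrier G)
        = carrier (unitary_extension G)
    \<and> (\<exists>\<Phi> \<in> iso (unitary_cover G) (unitary_extension G).
         \<forall>g\<in>carrier G. \<Phi> (unitary_cover_gen G g) = unitary_extension_gen G g)"
proof -
  interpret finite_group G
    using assms by (simp add: finite_group_def finite_group_axioms_def)
  obtain q where q: "q \<in> iso (unitary_extension G) (unitary_cover G)"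
    "\<forall>g\<in>carrier G. q (unitary_extension_gen G g) = unitary_cover_gen G g"
    using unitary_extension_iso by blast
  \<comment> \<open>The inverse of \<open>q\<close> is taken because maps are easily prescribed only
    out of the quotient of the free product.\<close>
  let ?\<Phi> = "inv_into (carrier (unitary_extension G)) q"
  have "?\<Phi> \<in> iso (unitary_cover G) (unitary_extension G)"
    using group.iso_set_sym[OF group_unitary_extension q(1)] .
  moreover have "?\<Phi> (unitary_cover_gen G g) = unitary_extension_gen G g" if g: "g \<in> carrier G" for g
  proof -
    have "unitary_extension_gen G g \<in> carrier (unitary_extension G)"
      using g generate.incl[of "unitary_extension_gen G g" "unitary_extension_gen G ` carrier G"]
      by (simp flip: generate_unitary_extension)
    then show ?thesis
      using q g inv_into_f_f[of q "carrier (unitary_extension G)" "unitary_extension_gen G g"]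
      by (simp add: iso_def bij_betw_def)
  qed
  ultimately show ?thesis
    using unitary_cover_generate generate_unitary_extension by blast
qed

end
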